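(* $\textsc{\#Disj2Sat}$ is hard for $\mathsf{\Sigma QSO(\Sigma_2\text{-}2SAT)}$ under parsimonious reductions: for every relational vocabulary $\sigma$ and every $\mathsf{\Sigma QSO(\Sigma_2\text{-}2SAT)}$ sentence $\alpha$ over $\sigma$, there is a function, computable in time polynomial in the size of the input structure, mapping each finite ordered $\sigma$-structure $\mathcal{A}$ to a propositional formula $\phi_{\alpha_{\mathcal{A}}}$ that is a disjunction of 2SAT formulae and satisfies $[[\alpha]](\mathcal{A})=\textsc{\#Disj2Sat}(\phi_{\alpha_{\mathcal{A}}})$.
   Context: $\textsc{\#Disj2Sat}$: given a propositional formula that is a disjunction of 2SAT formulae (each a conjunction of clauses with at most two literals), output its number of satisfying assignments. $\mathsf{\Sigma QSO(\Sigma_2\text{-}2SAT)}$: first-order formulae over a relational vocabulary $\sigma$ are built by $\phi ::= x=y \mid R(\vec x) \mid \neg\phi \mid \phi\vee\phi \mid \exists x\phi \mid \top \mid \bot$ with $R\in\sigma$. A literal is $X(\vec x)$ or $\neg X(\vec x)$ with $X$ a second-order variable. A 2SAT clause over $\sigma$ is $\phi_1\vee\phi_2\vee\phi_3$ where each $\phi_i$ is a literal or a first-order formula over $\sigma$, at least one $\phi_i$ being a first-order formula. A $\Sigma_2$-2SAT formula is $\exists\vec x\forall\vec y\bigwedge_{j=1}^k C_j(\vec x,\vec y)$ with each $C_j$ a 2SAT clause. $\mathsf{\Sigma QSO(\Sigma_2\text{-}2SAT)}$ formulae: $\alpha ::= \phi \mid s \mid (\alpha+\alpha)\mid \Sigma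 x.\alpha \mid \Sigma X.\alpha$, with $\phi$ a $\Sigma_2$-2SAT formula, $s\in\mathbb{N}$. Semantics: $[[\phi]]=1$ if the structure (with the current assignments) satisfies $\phi$, else $0$; $[[s]]=s$; $+$ is addition; $[[\Sigma x.\alpha]](\mathcal{A},v,V)=\sum_{a\in A}[[\alpha]](\mathcal{A},v[a/x],V)$; $[[\Sigma X.\alpha]](\mathcal{A},v,V)=\sum_{B\subseteq A^{\mathrm{arity}(X)}}[[\alpha]](\mathcal{A},v,V[B/X])$. A sentence (no free variables) $\alpha$ defines the counting function $\mathcal{A}\mapsto[[\alpha]](\mathcal{A})$. A parsimonious reduction from $f$ to $g$ is a polynomial-time computable $h$ with $f(x)=g(h(x))$ for all inputs $x$. *)

theory Defs
  imports "HOL-Computational_Algebra.Polynomial"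
begin

section \<open>Finite ordered structures\<close>

text \<open>A relational vocabulary is a finite list of relation symbols, given by their arities: the
  symbol number \<open>i < length \<sigma>\<close> has arity \<open>\<sigma> ! i\<close>.\<close>

type_synonym vocabulary = "nat list"

text \<open>The linear order is a component of the structure of its own. It is visible to formulae only
  if \<open>\<sigma>\<close> contains a binary symbol that is interpreted by it; structures of that kind are among
  those considered here.\<close>

record 'a ordered_structure =
  univ :: "'a set"
  ord :: "'a rel"
  rel :: "nat \<Rightarrow> 'a list set"

definition tuples :: "'a set \<Rightarrow> nat \<Rightarrow> 'a list set" where
  "tuples U k = {xs. length xs = k \<and> set xs \<subseteq> U}"

definition ordered_structures :: "vocabulary \<Rightarrow> 'a ordered_structure set" where
  "ordered_structures \<sigma> =
     {A. finite (univ A) \<and> univ A \<noteq> {} \<and> linear_order_on (univ A) (ord A) \<and>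
         (\<forall>i < length \<sigma>. rel A i \<subseteq> tuples (univ A) (\<sigma> ! i))}"


section \<open>The logic\<close>

type_synonym fovar = nat

text \<open>A second-order variable is a name together with an arity.\<close>

type_synonym sovar = "nat \<times> nat"

abbreviation arity :: "sovar \<Rightarrow> nat" where
  "arity \<equiv> snd"

type_synonym 'a fo_assignment = "fovar \<Rightarrow> 'a"
type_synonym 'a so_assignment = "sovar \<Rightarrow> 'a list set"

subsection \<open>First-order formulae\<close>

datatype fo =
    FEq fovar fovar
  | FRel nat "fovar list"
  | FNot fo
  | FOr fo fo
  | FEx fovar fo
  | FTrue
  | FFalse

fun wf_fo :: "vocabulary \<Rightarrow> fo \<Rightarrow> bool" where
  "wf_fo \<sigma> (FEq x y) \<longleftrightarrow> True"
| "wf_fo \<sigma> (FRel i xs) \<longleftrightarrow> i < length \<sigma> \<and> length xs = \<sigma> ! i"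
| "wf_fo \<sigma> (FNot \<phi>) \<longleftrightarrow> wf_fo \<sigma> \<phi>"
| "wf_fo \<sigma> (FOr \<phi> \<psi>) \<longleftrightarrow> wf_fo \<sigma> \<phi> \<and> wf_fo \<sigma> \<psi>"
| "wf_fo \<sigma> (FEx x \<phi>) \<longleftrightarrow> wf_fo \<sigma> \<phi>"
| "wf_fo \<sigma> FTrue \<longleftrightarrow> True"
| "wf_fo \<sigma> FFalse \<longleftrightarrow> True"

fun fv_fo :: "fo \<Rightarrow> fovar set" where
  "fv_fo (FEq x y) = {x, y}"
| "fv_fo (FRel i xs) = set xs"
| "fv_fo (FNot \<phi>) = fv_fo \<phi>"
| "fv_fo (FOr \<phi> \<psi>) = fv_fo \<phi> \<union> fv_fo \<psi>"
| "fv_fo (FEx x \<phi>) = fv_fo \<phi> - {x}"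
| "fv_fo FTrue = {}"
| "fv_fo FFalse = {}"

fun sat_fo :: "'a ordered_structure \<Rightarrow> 'a fo_assignment \<Rightarrow> fo \<Rightarrow> bool" where
  "sat_fo A v (FEq x y) \<longleftrightarrow> v x = v y"
| "sat_fo A v (FRel i xs) \<longleftrightarrow> map v xs \<in> rel A i"
| "sat_fo A v (FNot \<phi>) \<longleftrightarrow> \<not> sat_fo A v \<phi>"
| "sat_fo A v (FOr \<phi> \<psi>) \<longleftrightarrow> sat_fo A v \<phi> \<or> sat_fo A v \<psi>"
| "sat_fo A v (FEx x \<phi>) \<longleftrightarrow> (\<exists>a \<in> univ A. sat_fo A (v(x := a)) \<phi>)"
| "sat_fo A v FTrue \<longleftrightarrow> True"
| "sat_fo A v FFalse \<longleftrightarrow> False"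

subsection \<open>\<open>\<Sigma>\<^sub>2\<close>-2SAT formulae\<close>

datatype disjunct =
    Pos sovar "fovar list"
  | Neg sovar "fovar list"
  | FO fo

datatype clause = Clause disjunct disjunct disjunct

text \<open>\<open>Sigma2 xs ys Cs\<close> stands for \<open>\<exists>xs \<forall>ys \<And>Cs\<close>.\<close>

datatype sigma2 = Sigma2 "fovar list" "fovar list" "clause list"

fun is_FO :: "disjunct \<Rightarrow> bool" where
  "is_FO (FO \<phi>) \<longleftrightarrow> True"
| "is_FO _ \<longleftrightarrow> False"

fun wf_disjunct :: "vocabulary \<Rightarrow> disjunct \<Rightarrow> bool" where
  "wf_disjunct \<sigma> (Pos X xs) \<longleftrightarrow> length xs = arity X"
| "wf_disjunct \<sigma> (Neg X xs) \<longleftrightarrow> length xs = arity X"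
| "wf_disjunct \<sigma> (FO \<phi>) \<longleftrightarrow> wf_fo \<sigma> \<phi>"

fun wf_clause :: "vocabulary \<Rightarrow> clause \<Rightarrow> bool" where
  "wf_clause \<sigma> (Clause d1 d2 d3) \<longleftrightarrow>
     wf_disjunct \<sigma> d1 \<and> wf_disjunct \<sigma> d2 \<and> wf_disjunct \<sigma> d3 \<and>
     (is_FO d1 \<or> is_FO d2 \<or> is_FO d3)"

fun wf_sigma2 :: "vocabulary \<Rightarrow> sigma2 \<Rightarrow> bool" where
  "wf_sigma2 \<sigma> (Sigma2 xs ys Cs) \<longleftrightarrow> (\<forall>C \<in> set Cs. wf_clause \<sigma> C)"

fun fv_disjunct :: "disjunct \<Rightarrow> fovar set" where
  "fv_disjunct (Pos X xs) = set xs"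
| "fv_disjunct (Neg X xs) = set xs"
| "fv_disjunct (FO \<phi>) = fv_fo \<phi>"

fun fv_clause :: "clause \<Rightarrow> fovar set" where
  "fv_clause (Clause d1 d2 d3) = fv_disjunct d1 \<union> fv_disjunct d2 \<union> fv_disjunct d3"

fun fv_sigma2 :: "sigma2 \<Rightarrow> fovar set" where
  "fv_sigma2 (Sigma2 xs ys Cs) = (\<Union>C \<in> set Cs. fv_clause C) - set xs - set ys"

fun sov_disjunct :: "disjunct \<Rightarrow> sovar set" where
  "sov_disjunct (Pos X xs) = {X}"
| "sov_disjunct (Neg X xs) = {X}"
| "sov_disjunct (FO \<phi>) = {}"

fun sov_clause :: "clause \<Rightarrow> sovar set" where
  "sov_clause (Clause d1 d2 d3) = sov_disjunct d1 \<union> sov_disjunct d2 \<union> sov_disjunct d3"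

fun sov_sigma2 :: "sigma2 \<Rightarrow> sovar set" where
  "sov_sigma2 (Sigma2 xs ys Cs) = (\<Union>C \<in> set Cs. sov_clause C)"

fun sat_disjunct ::
  "'a ordered_structure \<Rightarrow> 'a fo_assignment \<Rightarrow> 'a so_assignment \<Rightarrow> disjunct \<Rightarrow> bool" where
  "sat_disjunct A v V (Pos X xs) \<longleftrightarrow> map v xs \<in> V X"
| "sat_disjunct A v V (Neg X xs) \<longleftrightarrow> map v xs \<notin> V X"
| "sat_disjunct A v V (FO \<phi>) \<longleftrightarrow> sat_fo A v \<phi>"

fun sat_clause ::
  "'a ordered_structure \<Rightarrow> 'a fo_assignment \<Rightarrow> 'a so_assignment \<Rightarrow> clause \<Rightarrow> bool" where
  "sat_clause A v V (Clause d1 d2 d3) \<longleftrightarrow>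
     sat_disjunct A v V d1 \<or> sat_disjunct A v V d2 \<or> sat_disjunct A v V d3"

fun ex_block :: "'a set \<Rightarrow> fovar list \<Rightarrow> ('a fo_assignment \<Rightarrow> bool) \<Rightarrow> 'a fo_assignment \<Rightarrow> bool" where
  "ex_block U [] P v \<longleftrightarrow> P v"
| "ex_block U (x # xs) P v \<longleftrightarrow> (\<exists>a \<in> U. ex_block U xs P (v(x := a)))"

fun all_block :: "'a set \<Rightarrow> fovar list \<Rightarrow> ('a fo_assignment \<Rightarrow> bool) \<Rightarrow> 'a fo_assignment \<Rightarrow> bool" where
  "all_block U [] P v \<longleftrightarrow> P v"
| "all_block U (x # xs) P v \<longleftrightarrow> (\<forall>a \<in> U. all_block U xs P (v(x := a)))"

fun sat_sigma2 ::
  "'a ordered_structure \<Rightarrow> 'a fo_assignment \<Rightarrow> 'a so_assignment \<Rightarrow> sigma2 \<Rightarrow> bool" where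
  "sat_sigma2 A v V (Sigma2 xs ys Cs) \<longleftrightarrow>
     ex_block (univ A) xs (all_block (univ A) ys (\<lambda>w. \<forall>C \<in> set Cs. sat_clause A w V C)) v"

subsection \<open>\<open>\<Sigma>QSO(\<Sigma>\<^sub>2-2SAT)\<close>\<close>

datatype qso =
    Formula sigma2
  | Const nat
  | Plus qso qso
  | SumFO fovar qso
  | SumSO sovar qso

fun wf_qso :: "vocabulary \<Rightarrow> qso \<Rightarrow> bool" where
  "wf_qso \<sigma> (Formula \<phi>) \<longleftrightarrow> wf_sigma2 \<sigma> \<phi>"
| "wf_qso \<sigma> (Const s) \<longleftrightarrow> True"
| "wf_qso \<sigma> (Plus \<alpha> \<beta>) \<longleftrightarrow> wf_qso \<sigma> \<alpha> \<and> wf_qso \<sigma> \<beta>"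
| "wf_qso \<sigma> (SumFO x \<alpha>) \<longleftrightarrow> wf_qso \<sigma> \<alpha>"
| "wf_qso \<sigma> (SumSO X \<alpha>) \<longleftrightarrow> wf_qso \<sigma> \<alpha>"

fun fv_qso :: "qso \<Rightarrow> fovar set" where
  "fv_qso (Formula \<phi>) = fv_sigma2 \<phi>"
| "fv_qso (Const s) = {}"
| "fv_qso (Plus \<alpha> \<beta>) = fv_qso \<alpha> \<union> fv_qso \<beta>"
| "fv_qso (SumFO x \<alpha>) = fv_qso \<alpha> - {x}"
| "fv_qso (SumSO X \<alpha>) = fv_qso \<alpha>"

fun sov_qso :: "qso \<Rightarrow> sovar set" where
  "sov_qso (Formula \<phi>) = sov_sigma2 \<phi>"
| "sov_qso (Const s) = {}"
| "sov_qso (Plus \<alpha> \<beta>) = sov_qso \<alpha> \<union> sov_qso \<beta>"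
| "sov_qso (SumFO x \<alpha>) = sov_qso \<alpha>"
| "sov_qso (SumSO X \<alpha>) = sov_qso \<alpha> - {X}"

definition qso_sentence :: "vocabulary \<Rightarrow> qso \<Rightarrow> bool" where
  "qso_sentence \<sigma> \<alpha> \<longleftrightarrow> wf_qso \<sigma> \<alpha> \<and> fv_qso \<alpha> = {} \<and> sov_qso \<alpha> = {}"

fun qso_sem ::
  "'a ordered_structure \<Rightarrow> 'a fo_assignment \<Rightarrow> 'a so_assignment \<Rightarrow> qso \<Rightarrow> nat" where
  "qso_sem A v V (Formula \<phi>) = (if sat_sigma2 A v V \<phi> then 1 else 0)"
| "qso_sem A v V (Const s) = s"
| "qso_sem A v V (Plus \<alpha> \<beta>) = qso_sem A v V \<alpha> + qso_sem A v V \<beta>"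
| "qso_sem A v V (SumFO x \<alpha>) = (\<Sum>a \<in> univ A. qso_sem A (v(x := a)) V \<alpha>)"
| "qso_sem A v V (SumSO X \<alpha>) = (\<Sum>B \<in> Pow (tuples (univ A) (arity X)). qso_sem A v (V(X := B)) \<alpha>)"

text \<open>The counting function defined by a sentence. The initial assignments are arbitrary, since the
  value of a sentence does not depend on them.\<close>

definition qso_count :: "qso \<Rightarrow> 'a ordered_structure \<Rightarrow> nat" where
  "qso_count \<alpha> A = qso_sem A (\<lambda>_. SOME a. a \<in> univ A) (\<lambda>_. {}) \<alpha>"


section \<open>Disjunctions of 2SAT formulae\<close>

text \<open>Propositional variables are natural numbers. A formula is a list (disjunction) of lists
  (conjunctions) of clauses, and a clause is a list (disjunction) of literals.\<close>

datatype plit = PPos nat | PNeg nat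

type_synonym pclause = "plit list"
type_synonym pcnf = "pclause list"
type_synonym pformula = "pcnf list"

definition disj2sat :: "pformula set" where
  "disj2sat = {F. \<forall>G \<in> set F. \<forall>C \<in> set G. length C \<le> 2}"

fun pvar :: "plit \<Rightarrow> nat" where
  "pvar (PPos p) = p"
| "pvar (PNeg p) = p"

definition pvars :: "pformula \<Rightarrow> nat set" where
  "pvars F = (\<Union>G \<in> set F. \<Union>C \<in> set G. pvar ` set C)"

text \<open>A truth assignment is the set of variables that it makes true.\<close>

fun sat_plit :: "nat set \<Rightarrow> plit \<Rightarrow> bool" where
  "sat_plit T (PPos p) \<longleftrightarrow> p \<in> T"
| "sat_plit T (PNeg p) \<longleftrightarrow> p \<notin> T"

definition sat_pformula :: "nat set \<Rightarrow> pformula \<Rightarrow> bool" where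
  "sat_pformula T F \<longleftrightarrow> (\<exists>G \<in> set F. \<forall>C \<in> set G. \<exists>l \<in> set C. sat_plit T l)"

definition count_disj2sat :: "pformula \<Rightarrow> nat" where
  "count_disj2sat F = card {T. T \<subseteq> pvars F \<and> sat_pformula T F}"


section \<open>Polynomial-time computability\<close>

text \<open>The machine model: structured programs over finitely many stacks of bits. Every push, pop and
  test inspects or changes only the top of one stack and costs one step, so that a program is
  a multi-tape Turing machine (one tape per stack, whose head stays at the top of the stack), and
  conversely a tape is simulated by two stacks, both with constant overhead per step.\<close>

datatype test =
    Nonempty nat
  | Top nat

datatype prog =
    Skip
  | Push nat bool
  | Pop nat
  | Seq prog prog
  | If test prog prog
  | While test prog

type_synonym store = "nat \<Rightarrow> bool list"

fun holds :: "test \<Rightarrow> store \<Rightarrow> bool" where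
  "holds (Nonempty r) s \<longleftrightarrow> s r \<noteq> []"
| "holds (Top r) s \<longleftrightarrow> (case s r of [] \<Rightarrow> False | b # _ \<Rightarrow> b)"

text \<open>\<open>exec c s t s'\<close>: started in \<open>s\<close>, the program \<open>c\<close> halts in \<open>s'\<close> after \<open>t\<close> steps.\<close>

inductive exec :: "prog \<Rightarrow> store \<Rightarrow> nat \<Rightarrow> store \<Rightarrow> bool" where
  Skip: "exec Skip s 1 s"
| Push: "exec (Push r b) s 1 (s(r := b # s r))"
| Pop: "exec (Pop r) s 1 (s(r := tl (s r)))"
| Seq: "exec c1 s t1 s1 \<Longrightarrow> exec c2 s1 t2 s2 \<Longrightarrow> exec (Seq c1 c2) s (t1 + t2) s2"
| IfTrue: "holds e s \<Longrightarrow> exec c1 s t s' \<Longrightarrow> exec (If e c1 c2) s (Suc t) s'"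
| IfFalse: "\<not> holds e s \<Longrightarrow> exec c2 s t s' \<Longrightarrow> exec (If e c1 c2) s (Suc t) s'"
| WhileFalse: "\<not> holds e s \<Longrightarrow> exec (While e c) s 1 s"
| WhileTrue: "holds e s \<Longrightarrow> exec c s t1 s1 \<Longrightarrow> exec (While e c) s1 t2 s2 \<Longrightarrow>
    exec (While e c) s (Suc (t1 + t2)) s2"

lemma exec_deterministic:
  assumes "exec c s t s'" and "exec c s u s''"
  shows "t = u \<and> s' = s''"
  using assms
proof (induction arbitrary: u s'' rule: exec.induct)
  case (Skip s)
  then show ?case by cases auto
next
  case (Push r b s)
  then show ?case by cases auto
next
  case (Pop r s)
  then show ?case by cases auto
next
  case (Seq c1 s t1 s1 c2 t2 s2)
  from Seq.prems show ?case by cases (use Seq.IH in blast)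
next
  case (IfTrue e s c1 t s' c2)
  from IfTrue.prems show ?case by cases (use IfTrue.IH IfTrue.hyps in blast)+
next
  case (IfFalse e s c2 t s' c1)
  from IfFalse.prems show ?case by cases (use IfFalse.IH IfFalse.hyps in blast)+
next
  case (WhileFalse e s c)
  from WhileFalse.prems show ?case by cases (use WhileFalse.hyps in auto)
next
  case (WhileTrue e s c t1 s1 t2 s2)
  from WhileTrue.prems show ?case by cases (use WhileTrue.IH WhileTrue.hyps(1) in blast)+
qed

text \<open>The input is placed on stack \<open>0\<close>, all other stacks being empty, and the output is read off
  stack \<open>1\<close>. The function \<open>f\<close> need only be computed on encodings of elements of \<open>S\<close>.\<close>

definition poly_time_computable ::
  "'i set \<Rightarrow> ('i \<Rightarrow> bool list) \<Rightarrow> ('o \<Rightarrow> bool list) \<Rightarrow> ('i \<Rightarrow> 'o) \<Rightarrow> bool" where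
  "poly_time_computable S enc_in enc_out f \<longleftrightarrow>
     (\<exists>(c :: prog) (p :: nat poly). \<forall>x \<in> S. \<exists>t s.
        exec c ((\<lambda>_. [])(0 := enc_in x)) t s \<and> s 1 = enc_out (f x) \<and>
        t \<le> poly p (length (enc_in x)))"

definition parsimonious_reduction ::
  "'i set \<Rightarrow> ('i \<Rightarrow> bool list) \<Rightarrow> ('i \<Rightarrow> nat) \<Rightarrow>
   'o set \<Rightarrow> ('o \<Rightarrow> bool list) \<Rightarrow> ('o \<Rightarrow> nat) \<Rightarrow> ('i \<Rightarrow> 'o) \<Rightarrow> bool" where
  "parsimonious_reduction S enc_in f T enc_out g h \<longleftrightarrow>
     poly_time_computable S enc_in enc_out h \<and> (\<forall>x \<in> S. h x \<in> T \<and> f x = g (h x))"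

subsection \<open>Encodings\<close>

text \<open>The elements of the universe in increasing order.\<close>

definition enumeration :: "'a ordered_structure \<Rightarrow> 'a list" where
  "enumeration A =
     (THE us. set us = univ A \<and> distinct us \<and> sorted_wrt (\<lambda>a b. (a, b) \<in> ord A) us)"

lemma enumeration_ex1:
  assumes "finite (univ A)" and lin: "linear_order_on (univ A) (ord A)"
  shows "\<exists>!us. set us = univ A \<and> distinct us \<and> sorted_wrt (\<lambda>a b. (a, b) \<in> ord A) us"
proof -
  let ?r = "ord A"
  have tr: "trans ?r" and anti: "antisym ?r"
    using lin by (auto simp: order_on_defs)
  have total: "(a, b) \<in> ?r \<or> (b, a) \<in> ?r" if "a \<in> univ A" "b \<in> univ A" for a b
    using lin that by (cases "a = b") (auto simp: order_on_defs refl_on_def total_on_def)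
  have min_ex: "\<exists>m\<in>U. \<forall>a\<in>U. (m, a) \<in> ?r" if "finite U" "U \<noteq> {}" "U \<subseteq> univ A" for U
    using that
  proof (induction U rule: finite_ne_induct)
    case (singleton a)
    then show ?case using total[of a a] by auto
  next
    case (insert a U)
    then obtain m where m: "m \<in> U" "\<forall>b\<in>U. (m, b) \<in> ?r" by auto
    show ?case
    proof (cases "(a, m) \<in> ?r")
      case True
      then have "\<forall>b\<in>U. (a, b) \<in> ?r" using m tr by (meson transD)
      then show ?thesis using total[of a a] insert.prems by simp
    next
      case False
      then have "(m, a) \<in> ?r" using total[of a m] m(1) insert.prems by blast
      then show ?thesis using m by blast
    qed
  qed
  have ex: "\<exists>us. set us = U \<and> distinct us \<and> sorted_wrt (\<lambda>a b. (a, b) \<in> ?r) us"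
    if "finite U" "U \<subseteq> univ A" for U
    using that
  proof (induction U rule: finite_psubset_induct)
    case (psubset U)
    show ?case
    proof (cases "U = {}")
      case False
      with psubset.hyps psubset.prems obtain m where m: "m \<in> U" "\<forall>a\<in>U. (m, a) \<in> ?r"
        using min_ex[of U] by blast
      then have "U - {m} \<subset> U" "U - {m} \<subseteq> univ A" using psubset.prems by auto
      from psubset.IH[OF this] obtain us where
        "set us = U - {m}" "distinct us" "sorted_wrt (\<lambda>a b. (a, b) \<in> ?r) us"
        by blast
      with m have "set (m # us) = U \<and> distinct (m # us) \<and> sorted_wrt (\<lambda>a b. (a, b) \<in> ?r) (m # us)"
        by auto
      then show ?thesis by blast
    qed auto
  qed
  have unique: "us = vs"
    if "set us = set vs" "distinct us" "distinct vs"
      "sorted_wrt (\<lambda>a b. (a, b) \<in> ?r) us" "sorted_wrt (\<lambda>a b. (a, b) \<in> ?r) vs" for us vs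
    using that
  proof (induction us arbitrary: vs)
    case (Cons u us)
    then obtain v vs' where vs: "vs = v # vs'" by (cases vs) auto
    have "u = v"
    proof (rule ccontr)
      assume "u \<noteq> v"
      with Cons.prems(1) vs have "v \<in> set us" "u \<in> set vs'" by auto
      with Cons.prems(4,5) vs have "(u, v) \<in> ?r" "(v, u) \<in> ?r" by auto
      with anti \<open>u \<noteq> v\<close> show False by (auto dest: antisymD)
    qed
    with Cons.prems vs have "set us = set vs'" by auto
    with Cons.IH Cons.prems vs have "us = vs'" by auto
    with \<open>u = v\<close> vs show ?case by simp
  qed auto
  show ?thesis
  proof (rule ex_ex1I)
    show "\<exists>us. set us = univ A \<and> distinct us \<and> sorted_wrt (\<lambda>a b. (a, b) \<in> ?r) us"
      using ex[of "univ A"] assms(1) by simp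
  qed (use unique in simp)
qed

text \<open>The usual encoding of an ordered structure: the size of the universe in unary, followed by the
  characteristic bit string, of length \<open>n ^ k\<close>, of each \<open>k\<close>-ary relation, the tuples being
  listed lexicographically.\<close>

definition enc_structure :: "vocabulary \<Rightarrow> 'a ordered_structure \<Rightarrow> bool list" where
  "enc_structure \<sigma> A =
     replicate (card (univ A)) True @ [False] @
     concat (map (\<lambda>i. map (\<lambda>xs. xs \<in> rel A i)
                            (product_lists (replicate (\<sigma> ! i) (enumeration A))))
                 [0..<length \<sigma>])"

text \<open>Propositional variables are written in unary. This only makes the requirement on the
  reduction stronger: unary numerals are converted to binary ones in polynomial time.\<close>

fun enc_plit :: "plit \<Rightarrow> bool list" where
  "enc_plit (PPos p) = True # replicate p True @ [False]"
| "enc_plit (PNeg p) = False # replicate p True @ [False]"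

definition enc_list :: "('b \<Rightarrow> bool list) \<Rightarrow> 'b list \<Rightarrow> bool list" where
  "enc_list enc xs = concat (map (\<lambda>x. True # enc x) xs) @ [False]"

definition enc_pformula :: "pformula \<Rightarrow> bool list" where
  "enc_pformula = enc_list (enc_list (enc_list enc_plit))"

definition prefix_free :: "('b \<Rightarrow> bool list) \<Rightarrow> bool" where
  "prefix_free enc \<longleftrightarrow> (\<forall>x y u v. enc x @ u = enc y @ v \<longrightarrow> x = y \<and> u = v)"

lemma prefix_free_enc_plit: "prefix_free enc_plit"
proof -
  have *: "replicate p True @ False # u = replicate q True @ False # v \<Longrightarrow> p = q \<and> u = v" for p q u v
  proof (induction p arbitrary: q)
    case 0 then show ?case by (cases q) auto
  next
    case (Suc p) then show ?case by (cases q) auto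
  qed
  have "l = l' \<and> u = v" if "enc_plit l @ u = enc_plit l' @ v" for l l' u v
    using that by (cases l; cases l') (auto dest: *)
  then show ?thesis unfolding prefix_free_def by blast
qed

lemma prefix_free_enc_list:
  assumes "prefix_free enc"
  shows "prefix_free (enc_list enc)"
proof -
  have "xs = ys \<and> u = v" if "enc_list enc xs @ u = enc_list enc ys @ v" for xs ys u v
    using that
  proof (induction xs arbitrary: ys)
    case Nil then show ?case by (cases ys) (auto simp: enc_list_def)
  next
    case (Cons x xs)
    then obtain y ys' where ys: "ys = y # ys'" by (cases ys) (auto simp: enc_list_def)
    with Cons.prems have "enc x @ (enc_list enc xs @ u) = enc y @ (enc_list enc ys' @ v)"
      by (simp add: enc_list_def)
    with assms have "x = y" "enc_list enc xs @ u = enc_list enc ys' @ v"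
      unfolding prefix_free_def by blast+
    with Cons.IH[of ys'] ys show ?case by simp
  qed
  then show ?thesis unfolding prefix_free_def by blast
qed

lemma inj_enc_pformula: "inj enc_pformula"
proof -
  have "prefix_free enc_pformula"
    unfolding enc_pformula_def by (intro prefix_free_enc_list prefix_free_enc_plit)
  then show ?thesis
    unfolding prefix_free_def inj_def by metis
qed

end

theory Submission
  imports Defs
begin

text \<open>The propositional variables are arranged in blocks, one for each second-order or first-order
  binder of the sentence, plus selector variables that decide the sums and constants. A block of a
  second-order variable describes a relation; in a block of a first-order variable exactly one
  variable is true. For every choice of summand and of values for the first-order variables and for
  the existential quantifiers of the chosen formula there is one disjunct: it fixes the choice by
  unit clauses, sets the blocks of the other summands to false, and contains the remaining clauses
  after evaluating their first-order parts in the structure. Since the values of the existential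
  quantifiers are not recorded, the satisfying assignments correspond exactly to what the sentence
  counts.

  The polynomial time bound comes from writing the formula as a template that depends on the
  sentence alone and that is expanded by nested loops over the universe. Such templates are compiled
  to the machine, and the running time is bounded by a polynomial defined by recursion on the
  compiled expression.\<close>

section \<open>Running programs within a time bound\<close>

text \<open>Counting imposes two constraints. \<open>count_disj2sat\<close> ranges over the
  variables that occur in the formula, so every disjunct has to mention every block: an
  unconstrained block gets tautological clauses, and a block of another summand is fixed instead of
  being left out. Moreover an assignment counts once, however many disjuncts it satisfies. A choice
  that contributes to the sum must therefore be readable from the assignment, whereas the witnesses
  of an existential block, which together contribute at most 1, must not be.

  The 2SAT bound comes from evaluation: one of the three disjuncts of a clause is first-order and
  moves into the guard of the template, so at most two literals remain.

  All blocks get the same width \<open>n ^ K\<close>, where \<open>K\<close> is the largest arity of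
  a block. Then variable numbers are computed with fixed powers of \<open>n\<close>, and blocks are
  disjoint whatever their arities. Gaps in the numbering do no harm, because numbers that do not
  occur are not counted. As \<open>K\<close> depends on the sentence alone, even unary numbers have
  polynomial length.\<close>

definition run :: "prog \<Rightarrow> store \<Rightarrow> nat \<Rightarrow> store \<Rightarrow> bool" where
  "run c s B s' \<longleftrightarrow> (\<exists>t \<le> B. exec c s t s')"

definition top_bit :: "bool list \<Rightarrow> bool" where
  "top_bit xs \<longleftrightarrow> (case xs of [] \<Rightarrow> False | b # _ \<Rightarrow> b)"

lemma top_simps [simp]: "\<not> top_bit []" "top_bit (b # xs) = b"
  by (simp_all add: top_bit_def)

lemma holds_Top [simp]: "holds (Top r) s \<longleftrightarrow> top_bit (s r)"
  by (simp add: top_bit_def)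

declare holds.simps(2) [simp del]

lemma run_Skip: "1 \<le> B \<Longrightarrow> s' = s \<Longrightarrow> run Skip s B s'"
  unfolding run_def using exec.Skip by blast

lemma run_Push: "1 \<le> B \<Longrightarrow> s' = s(r := b # s r) \<Longrightarrow> run (Push r b) s B s'"
  unfolding run_def using exec.Push by blast

lemma run_Pop: "1 \<le> B \<Longrightarrow> s' = s(r := tl (s r)) \<Longrightarrow> run (Pop r) s B s'"
  unfolding run_def using exec.Pop by blast

lemma run_Seq:
  "run c1 s B1 s1 \<Longrightarrow> run c2 s1 B2 s2 \<Longrightarrow> B1 + B2 \<le> B \<Longrightarrow> run (Seq c1 c2) s B s2"
  unfolding run_def by (meson add_mono exec.Seq le_trans)

text \<open>Branches of different cost share one bound; this is why \<open>run\<close> bounds the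
  number of steps instead of stating it exactly.\<close>

lemma run_If:
  assumes "holds e s \<Longrightarrow> run c1 s B1 s'" "\<not> holds e s \<Longrightarrow> run c2 s B2 s'"
    and "Suc (max B1 B2) \<le> B"
  shows "run (If e c1 c2) s B s'"
proof (cases "holds e s")
  case True
  with assms(1) obtain t where "t \<le> B1" "exec c1 s t s'" unfolding run_def by blast
  with True assms(3) show ?thesis
    unfolding run_def by (intro exI[of _ "Suc t"]) (auto intro: exec.IfTrue)
next
  case False
  with assms(2) obtain t where "t \<le> B2" "exec c2 s t s'" unfolding run_def by blast
  with False assms(3) show ?thesis
    unfolding run_def by (intro exI[of _ "Suc t"]) (auto intro: exec.IfFalse)
qed

lemma run_WhileFalse: "\<not> holds e s \<Longrightarrow> 1 \<le> B \<Longrightarrow> s' = s \<Longrightarrow> run (While e c) s B s'"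
  unfolding run_def using exec.WhileFalse by blast

lemma run_WhileTrue:
  assumes "holds e s" "run c s B1 s1" "run (While e c) s1 B2 s2" "Suc (B1 + B2) \<le> B"
  shows "run (While e c) s B s2"
proof -
  from assms(2,3) obtain t1 t2 where
    "t1 \<le> B1" "exec c s t1 s1" "t2 \<le> B2" "exec (While e c) s1 t2 s2"
    unfolding run_def by blast
  with assms(1,4) show ?thesis
    unfolding run_def by (intro exI[of _ "Suc (t1 + t2)"]) (auto intro: exec.WhileTrue)
qed

lemma run_mono: "run c s B s' \<Longrightarrow> B \<le> B' \<Longrightarrow> run c s B' s'"
  unfolding run_def using le_trans by blast

lemma run_eq: "run c s B s' \<Longrightarrow> s' = s'' \<Longrightarrow> run c s B s''"
  by simp

text \<open>\<open>Q i\<close> is the store, apart from \<open>r\<close>, when \<open>i\<close>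
  passes remain. A pass costs \<open>B\<close> plus one test and one pop, and the failing test at
  the end costs one more step.\<close>

lemma run_countdown:
  assumes "\<And>i. i < k \<Longrightarrow>
    run c ((Q (Suc i))(r := replicate i True @ rest)) B ((Q i)(r := replicate i True @ rest))"
    and "\<not> top_bit rest"
  shows "run (While (Top r) (Seq (Pop r) c)) ((Q k)(r := replicate k True @ rest))
           (k * (B + 2) + 1) ((Q 0)(r := rest))"
  using assms(1)
proof (induction k)
  case 0
  then show ?case using assms(2) by (intro run_WhileFalse) auto
next
  case (Suc k)
  \<comment> \<open>\<open>back_subst\<close> exchanges the start store for an extensionally equal
    one, so that nested updates need only be compared pointwise.\<close>
  have "run (Seq (Pop r) c) ((Q (Suc k))(r := replicate (Suc k) True @ rest)) (B + 1)
          ((Q k)(r := replicate k True @ rest))"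
    by (rule run_Seq[where ?B1.0 = 1 and ?B2.0 = B], rule run_Pop[OF _ refl], simp,
        rule back_subst[of "\<lambda>x. run _ x _ _", OF Suc.prems[of k]]) (auto simp: fun_eq_iff)
  moreover have "run (While (Top r) (Seq (Pop r) c)) ((Q k)(r := replicate k True @ rest))
           (k * (B + 2) + 1) ((Q 0)(r := rest))"
    by (rule Suc.IH) (use Suc.prems in auto)
  ultimately show ?case
    by (rule run_WhileTrue[rotated]) auto
qed

section \<open>Unary numbers on stacks\<close>

text \<open>The block ends at the first zero or at the bottom of the stack. So an empty stack holds
  0, and the encoding of a structure holds the size of its universe.\<close>

definition uval :: "bool list \<Rightarrow> nat" where
  "uval xs = length (takeWhile (\<lambda>b. b) xs)"

lemma uval_simps [simp]:
  "uval [] = 0" "uval (True # xs) = Suc (uval xs)" "uval (False # xs) = 0"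
  by (simp_all add: uval_def)

lemma uval_replicate [simp]: "uval (replicate i True @ xs) = i + uval xs"
  by (induction i) auto

lemma uval_no_top: "\<not> top_bit xs \<Longrightarrow> uval xs = 0"
  by (cases xs) auto

lemma uval_split: "\<exists>rest. xs = replicate (uval xs) True @ rest \<and> \<not> top_bit rest"
proof (induction xs)
  case (Cons b xs)
  then show ?case by (cases b) auto
qed auto

text \<open>Stacks 0 and 1 are input and output, and registers start at 8. In between is scratch
  space: for copying, for truth values, for the counter of multiplications, for two operands, and
  for input bits set aside during a lookup.\<close>

abbreviation (input) "TMP \<equiv> 2 :: nat"
abbreviation (input) "EV \<equiv> 3 :: nat"
abbreviation (input) "CNT \<equiv> 4 :: nat"
abbreviation (input) "IDX \<equiv> 5 :: nat"
abbreviation (input) "IDY \<equiv> 6 :: nat"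
abbreviation (input) "BITS \<equiv> 7 :: nat"

abbreviation reg :: "nat \<Rightarrow> nat" where
  "reg r \<equiv> r + 8"

text \<open>The value of a register is the block of ones at the top of its stack. A loop opens a new
  block by pushing a zero first, so that it hides the previous value and finally restores it.\<close>

definition env :: "store \<Rightarrow> nat \<Rightarrow> nat" where
  "env s r = uval (s (reg r))"

lemma env_upd [simp]:
  "r < 8 \<Longrightarrow> env (s(r := xs)) = env s"
  "env (s(reg q := xs)) = (env s)(q := uval xs)"
  by (auto simp: env_def)

text \<open>Reading a block of ones destroys it, so the ones are parked on \<open>TMP\<close>, above
  a zero that marks their end, and then moved back. On \<open>d\<close> they join the block already
  there, which is how sums arise.\<close>

definition copy :: "nat \<Rightarrow> nat \<Rightarrow> prog" where
  "copy r d = Seq (Push TMP False)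
     (Seq (While (Top r) (Seq (Pop r) (Seq (Push TMP True) (Push d True))))
     (Seq (While (Top TMP) (Seq (Pop TMP) (Push r True))) (Pop TMP)))"

lemma replicate_Suc_diff: "i < k \<Longrightarrow> replicate (k - i) x = x # replicate (k - Suc i) x"
  by (simp flip: Suc_diff_Suc)

lemma run_copy:
  assumes "r \<noteq> TMP" "d \<noteq> TMP" "d \<noteq> r" and le: "uval (s r) \<le> n"
  shows "run (copy r d) s (7 * n + 4) (s(d := replicate (uval (s r)) True @ s d))"
proof -
  define k where "k = uval (s r)"
  obtain rest where rest: "s r = replicate k True @ rest" "\<not> top_bit rest"
    unfolding k_def using uval_split by blast
  \<comment> \<open>With \<open>i\<close> ones still to be moved, \<open>?Q i\<close> is the store
    on the way from \<open>r\<close> to \<open>TMP\<close>, and \<open>?R i\<close> the store on the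
    way back.\<close>
  let ?Q = "\<lambda>i. s(TMP := replicate (k - i) True @ False # s TMP, d := replicate (k - i) True @ s d)"
  let ?R = "\<lambda>i. s(d := replicate k True @ s d, r := replicate (k - i) True @ rest)"
  have 1: "run (While (Top r) (Seq (Pop r) (Seq (Push TMP True) (Push d True))))
         ((?Q k)(r := replicate k True @ rest)) (k * (2 + 2) + 1) ((?Q 0)(r := rest))"
    by (rule run_countdown[OF _ rest(2)], rule run_Seq, rule run_Push[OF _ refl, where B = 1],
        simp, rule run_Push[where B = 1])
      (use assms in \<open>auto simp: fun_eq_iff replicate_Suc_diff\<close>)
  have 2: "run (While (Top TMP) (Seq (Pop TMP) (Push r True)))
         ((?R k)(TMP := replicate k True @ False # s TMP)) (k * (1 + 2) + 1)
         ((?R 0)(TMP := False # s TMP))"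
    by (rule run_countdown, rule run_Push)
      (use assms in \<open>auto simp: fun_eq_iff replicate_Suc_diff\<close>)
  have k: "k \<le> n" using le by (simp add: k_def)
  show ?thesis
    unfolding copy_def
    apply (rule run_Seq[where ?B1.0 = 1 and ?B2.0 = "7 * n + 3"])
      apply (rule run_Push[OF _ refl], simp)
     apply (rule run_Seq[where ?B2.0 = "3 * n + 2"])
       apply (rule run_eq[OF run_mono])
         apply (rule back_subst[of "\<lambda>x. run _ x _ _", OF 1])
    using assms rest apply (auto simp: fun_eq_iff)[1]
        apply (rule order_refl)
       apply (rule refl)
      apply (rule run_Seq[where ?B2.0 = 1])
        apply (rule back_subst[of "\<lambda>x. run _ x _ _", OF 2])
    using assms rest uval_no_top[OF rest(2)] apply (auto simp: fun_eq_iff)[1]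
       apply (rule run_Pop)
    using assms rest k uval_no_top[OF rest(2)] apply (auto simp: fun_eq_iff)
    done
qed

text \<open>The loop variable runs downwards from \<open>n - 1\<close>: outputs are pushed onto a stack, so this is
  what makes them appear in increasing order from the top.\<close>

definition for_loop :: "nat \<Rightarrow> prog \<Rightarrow> prog" where
  "for_loop r c = Seq (Push r False) (Seq (copy 0 r) (Seq (While (Top r) (Seq (Pop r) c)) (Pop r)))"

text \<open>The old value of \<open>r\<close> lies below the zero pushed first and is uncovered by
  the last pop. Of the 9 extra steps per pass, 2 belong to the countdown and 7 to copying one unit
  of \<open>n\<close> from the input.\<close>

lemma run_for_loop:
  assumes body: "\<And>i. i < n \<Longrightarrow>
    run c ((Q (Suc i))(r := replicate i True @ False # s r)) B
      ((Q i)(r := replicate i True @ False # s r))"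
    and s: "Q n = s" and r: "r \<noteq> 0" "r \<noteq> TMP" and n: "uval (s 0) = n"
  shows "run (for_loop r c) s (n * (B + 9) + 7) ((Q 0)(r := s r))"
proof -
  have 1: "run (While (Top r) (Seq (Pop r) c)) ((Q n)(r := replicate n True @ False # s r))
           (n * (B + 2) + 1) ((Q 0)(r := False # s r))"
    by (rule run_countdown) (use body in auto)
  have 2: "run (copy 0 r) (s(r := False # s r)) (7 * n + 4)
     (s(r := replicate n True @ False # s r))"
    by (rule run_eq[OF run_copy]) (use r n in \<open>auto simp: fun_eq_iff\<close>)
  show ?thesis
    unfolding for_loop_def
    apply (rule run_Seq[where ?B1.0 = 1])
      apply (rule run_Push[OF _ refl], simp)
     apply (rule run_Seq[OF 2])
      apply (rule run_Seq)
        apply (rule 1[unfolded s])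
       apply (rule run_Pop[where B = 1])
        apply auto
    apply (auto simp: algebra_simps)
    done
qed

section \<open>Arithmetic expressions\<close>

text \<open>Products with \<open>n\<close> suffice: only fixed powers of \<open>n\<close> and
  numbers written in base \<open>n\<close> have to be computed.\<close>

datatype aexp = ANum nat | AVar nat | AAdd aexp aexp | ATimesN aexp

fun aval :: "nat \<Rightarrow> (nat \<Rightarrow> nat) \<Rightarrow> aexp \<Rightarrow> nat" where
  "aval n w (ANum k) = k"
| "aval n w (AVar r) = w r"
| "aval n w (AAdd e1 e2) = aval n w e1 + aval n w e2"
| "aval n w (ATimesN e) = n * aval n w e"

fun pushes :: "nat \<Rightarrow> nat \<Rightarrow> prog" where
  "pushes d 0 = Skip"
| "pushes d (Suc k) = Seq (Push d True) (pushes d k)"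

lemma run_pushes: "run (pushes d k) s (k + 1) (s(d := replicate k True @ s d))"
proof (induction k arbitrary: s)
  case 0
  then show ?case by (auto intro: run_Skip)
next
  case (Suc k)
  show ?case
    apply (simp only: pushes.simps)
    apply (rule run_Seq[where ?B1.0 = 1])
      apply (rule run_Push[OF _ refl], simp)
     apply (rule run_eq, rule Suc)
     apply (auto simp: fun_eq_iff replicate_app_Cons_same)
    done
qed

text \<open>Values accumulate as ones on \<open>d\<close>: a sum is two runs in sequence, and a
  product with \<open>n\<close> repeats the computation of the factor, so no intermediate result is
  stored.\<close>

fun acomp :: "nat \<Rightarrow> aexp \<Rightarrow> prog" where
  "acomp d (ANum k) = pushes d k"
| "acomp d (AVar r) = copy (reg r) d"
| "acomp d (AAdd e1 e2) = Seq (acomp d e1) (acomp d e2)"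
| "acomp d (ATimesN e) = for_loop CNT (acomp d e)"

abbreviation "pX \<equiv> [:0, 1:] :: nat poly"

text \<open>Comparison and lookup take time linear in their operands, so values need polynomial
  bounds just as times do. A register holds at most \<open>n\<close>.\<close>

fun amax :: "aexp \<Rightarrow> nat poly" where
  "amax (ANum k) = [:k:]"
| "amax (AVar r) = pX"
| "amax (AAdd e1 e2) = amax e1 + amax e2"
| "amax (ATimesN e) = pX * amax e"

fun atime :: "aexp \<Rightarrow> nat poly" where
  "atime (ANum k) = [:k + 1:]"
| "atime (AVar r) = [:4, 7:]"
| "atime (AAdd e1 e2) = atime e1 + atime e2"
| "atime (ATimesN e) = pX * (atime e + [:9:]) + [:7:]"

lemma aval_le_amax: "\<forall>r. w r \<le> n \<Longrightarrow> aval n w e \<le> poly (amax e) n"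
  by (induction e) (auto intro: add_mono)

text \<open>The invariant of all compiled programs: the input is intact, its leading block is
  \<open>n\<close>, and no register exceeds \<open>n\<close>.\<close>

definition frame :: "bool list \<Rightarrow> nat \<Rightarrow> store \<Rightarrow> bool" where
  "frame D n s \<longleftrightarrow> s 0 = D \<and> uval D = n \<and> (\<forall>r. env s r \<le> n)"

lemma frame_upd [simp]: "0 < r \<Longrightarrow> r < 8 \<Longrightarrow> frame D n (s(r := xs)) = frame D n s"
  by (simp add: frame_def)

lemma frame_reg: "frame D n s \<Longrightarrow> i \<le> n \<Longrightarrow> frame D n (s(reg r := replicate i True @ False # xs))"
  by (auto simp: frame_def)

text \<open>The conditions keep \<open>d\<close> apart from the registers and from the stacks that
  the evaluation works with: the input, the copying stack and the loop counter.\<close>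

lemma run_acomp:
  assumes "frame D n s" "d < 8" "d \<notin> {0, TMP, CNT}"
  shows "run (acomp d e) s (poly (atime e) n) (s(d := replicate (aval n (env s) e) True @ s d))"
  using assms(1)
proof (induction e arbitrary: s)
  case (ANum k)
  show ?case using run_pushes[of d k s] by (simp del: fun_upd_apply)
next
  case (AVar r)
  then have "run (copy (reg r) d) s (7 * n + 4) (s(d := replicate (env s r) True @ s d))"
    unfolding env_def by (intro run_copy) (use assms AVar in \<open>auto simp: frame_def env_def\<close>)
  then show ?case by (simp add: algebra_simps del: fun_upd_apply)
next
  case (AAdd e1 e2)
  show ?case
    apply (simp only: acomp.simps)
    apply (rule run_Seq[OF AAdd.IH(1)[OF AAdd.prems] run_eq[OF AAdd.IH(2)]])
    using AAdd.prems assms apply (auto simp: replicate_add add.commute simp del: fun_upd_apply simp add: fun_upd_same simp flip: replicate_add append_assoc)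
    done
next
  case (ATimesN e)
  let ?a = "aval n (env s) e"
  let ?Q = "\<lambda>i. s(d := replicate ((n - i) * ?a) True @ s d)"
  have "run (for_loop CNT (acomp d e)) s (n * (poly (atime e) n + 9) + 7) ((?Q 0)(CNT := s CNT))"
  proof (rule run_for_loop)
    fix i assume i: "i < n"
    then have *: "(n - i) * ?a = ?a + (n - Suc i) * ?a"
      by (metis Suc_diff_Suc mult_Suc)
    show "run (acomp d e) ((?Q (Suc i))(CNT := replicate i True @ False # s CNT)) (poly (atime e) n)
            ((?Q i)(CNT := replicate i True @ False # s CNT))"
      by (rule run_eq[OF ATimesN.IH])
        (use ATimesN.prems assms in \<open>auto simp: fun_eq_iff * replicate_add simp flip: fun_upd_def\<close>)
  qed (use ATimesN.prems in \<open>auto simp: frame_def\<close>)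
  then show ?case
    unfolding acomp.simps by (rule run_eq[OF run_mono]) (use assms in \<open>auto simp: fun_eq_iff\<close>)
qed

section \<open>Boolean expressions\<close>

datatype bexp = BConst bool | BLook aexp | BLe aexp aexp | BNot bexp | BOr bexp bexp | BEx nat bexp

text \<open>\<open>BLook e\<close> reads the input at the position \<open>e\<close>, positions beyond the end reading false.\<close>

fun bval :: "bool list \<Rightarrow> nat \<Rightarrow> (nat \<Rightarrow> nat) \<Rightarrow> bexp \<Rightarrow> bool" where
  "bval D n w (BConst b) \<longleftrightarrow> b"
| "bval D n w (BLook e) \<longleftrightarrow> top_bit (drop (aval n w e) D)"
| "bval D n w (BLe e1 e2) \<longleftrightarrow> aval n w e1 \<le> aval n w e2"
| "bval D n w (BNot b) \<longleftrightarrow> \<not> bval D n w b"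
| "bval D n w (BOr b1 b2) \<longleftrightarrow> bval D n w b1 \<or> bval D n w b2"
| "bval D n w (BEx r b) \<longleftrightarrow> (\<exists>i<n. bval D n (w(r := i)) b)"

definition push_top :: "nat \<Rightarrow> nat \<Rightarrow> prog" where
  "push_top r d = If (Top r) (Push d True) (Push d False)"

lemma run_push_top: "2 \<le> B \<Longrightarrow> s' = s(d := top_bit (s r) # s d) \<Longrightarrow> run (push_top r d) s B s'"
  unfolding push_top_def
  by (rule run_If[where ?B1.0 = 1 and ?B2.0 = 1]) (auto intro!: run_Push)

text \<open>Truncated subtraction: each one on \<open>IDY\<close> removes a one from
  \<open>IDX\<close> if there is any, and \<open>a \<le> b\<close> holds iff nothing is left of
  \<open>a\<close>. The remaining steps clear both operands together with their separating
  zeros.\<close>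

definition le_prog :: prog where
  "le_prog =
     Seq (While (Top IDY) (Seq (Pop IDY) (If (Top IDX) (Pop IDX) Skip)))
    (Seq (Pop IDY)
    (Seq (If (Top IDX) (Push EV False) (Push EV True))
    (Seq (While (Top IDX) (Seq (Pop IDX) Skip)) (Pop IDX))))"

lemma run_le_prog:
  assumes "s IDX = replicate a True @ False # xs" "s IDY = replicate b True @ False # ys"
  shows "run le_prog s (4 * b + 3 * a + 6) (s(IDX := xs, IDY := ys, EV := (a \<le> b) # s EV))"
proof -
  let ?Q = "\<lambda>i. s(IDX := replicate (a - (b - i)) True @ False # xs)"
  let ?R = "\<lambda>i. s(IDY := ys, EV := (a \<le> b) # s EV)"
  have 1: "run (While (Top IDY) (Seq (Pop IDY) (If (Top IDX) (Pop IDX) Skip)))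
         ((?Q b)(IDY := replicate b True @ False # ys)) (b * (2 + 2) + 1)
         ((?Q 0)(IDY := False # ys))"
  proof (rule run_countdown)
    fix i assume i: "i < b"
    show "run (If (Top IDX) (Pop IDX) Skip) ((?Q (Suc i))(IDY := replicate i True @ False # ys)) 2
            ((?Q i)(IDY := replicate i True @ False # ys))"
    proof (rule run_If[where ?B1.0 = 1 and ?B2.0 = 1])
      assume *: "holds (Top IDX) ((?Q (Suc i))(IDY := replicate i True @ False # ys))"
      have "a - (b - Suc i) = Suc (a - (b - i))"
        using i * by (cases "a - (b - Suc i)") auto
      then show "run (Pop IDX) ((?Q (Suc i))(IDY := replicate i True @ False # ys)) 1
            ((?Q i)(IDY := replicate i True @ False # ys))"
        by (intro run_Pop) (auto simp: fun_eq_iff)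
    next
      assume *: "\<not> holds (Top IDX) ((?Q (Suc i))(IDY := replicate i True @ False # ys))"
      have "a - (b - Suc i) = 0" "a - (b - i) = 0"
        using i * by (cases "a - (b - Suc i)"; auto)+
      then show "run Skip ((?Q (Suc i))(IDY := replicate i True @ False # ys)) 1
            ((?Q i)(IDY := replicate i True @ False # ys))"
        by (intro run_Skip) (auto simp: fun_eq_iff)
    qed auto
  qed auto
  have top_bit: "top_bit (replicate (a - b) True @ False # xs) \<longleftrightarrow> \<not> a \<le> b"
    by (cases "a - b") auto
  have 2: "run (While (Top IDX) (Seq (Pop IDX) Skip))
         ((?R (a - b))(IDX := replicate (a - b) True @ False # xs)) ((a - b) * (1 + 2) + 1)
         ((?R 0)(IDX := False # xs))"
    by (rule run_countdown) (auto intro: run_Skip)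
  show ?thesis
    unfolding le_prog_def
    apply (rule run_Seq[where ?B1.0 = "4 * b + 1" and ?B2.0 = "3 * a + 5"])
      apply (rule run_eq[OF run_mono])
        apply (rule back_subst[of "\<lambda>x. run _ x _ _", OF 1])
    using assms apply (auto simp: fun_eq_iff)[1]
       apply simp
      apply (rule refl)
     apply (rule run_Seq[where ?B1.0 = 1 and ?B2.0 = "3 * a + 4"])
       apply (rule run_Pop[OF _ refl], simp)
      apply (rule run_Seq[where ?B1.0 = 2 and ?B2.0 = "3 * a + 2"])
        apply (rule run_If[where ?B1.0 = 1 and ?B2.0 = 1 and
          s' = "(?R (a - b))(IDX := replicate (a - b) True @ False # xs)"])
          apply (rule run_Push, simp)
    using top_bit apply (auto simp: fun_eq_iff)[1]
         apply (rule run_Push, simp)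
    using top_bit apply (auto simp: fun_eq_iff)[1]
        apply simp
       apply (rule run_Seq)
         apply (rule 2)
        apply (rule run_Pop[where B = 1])
         apply (auto simp: fun_eq_iff)
    done
qed

text \<open>The bits before the position are moved to \<open>BITS\<close> and afterwards put back.
  \<open>IDY\<close> counts the bits actually moved, since the input may end before the position is
  reached.\<close>

definition look_prog :: prog where
  "look_prog =
     Seq (While (Top IDX) (Seq (Pop IDX)
            (If (Nonempty 0) (Seq (Push IDY True) (Seq (push_top 0 BITS) (Pop 0))) Skip)))
    (Seq (push_top 0 EV)
    (Seq (While (Top IDY) (Seq (Pop IDY) (Seq (push_top BITS 0) (Pop BITS))))
    (Seq (Pop IDY) (Pop IDX))))"

lemma run_look_prog:
  assumes "s IDX = replicate k True @ False # xs" "s IDY = False # ys"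
  shows "run look_prog s (12 * k + 6)
           (s(IDX := xs, IDY := ys, EV := top_bit (drop k (s 0)) # s EV))"
proof -
  define D where "D = s 0"
  let ?Q = "\<lambda>i. s(0 := drop (k - i) D,
    IDY := replicate (min (k - i) (length D)) True @ False # ys,
    BITS := rev (take (k - i) D) @ s BITS)"
  let ?R = "\<lambda>i. s(IDX := False # xs, EV := top_bit (drop k D) # s EV, 0 := drop i D,
    BITS := rev (take i D) @ s BITS)"
  let ?m = "min k (length D)"
  have 1: "run (While (Top IDX) (Seq (Pop IDX)
            (If (Nonempty 0) (Seq (Push IDY True) (Seq (push_top 0 BITS) (Pop 0))) Skip)))
         ((?Q k)(IDX := replicate k True @ False # xs)) (k * (5 + 2) + 1)
         ((?Q 0)(IDX := False # xs))"
  proof (rule run_countdown)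
    fix i assume i: "i < k"
    let ?s1 = "(?Q (Suc i))(IDX := replicate i True @ False # xs)"
    let ?s2 = "(?Q i)(IDX := replicate i True @ False # xs)"
    have ki: "k - i = Suc (k - Suc i)" using i by simp
    show "run (If (Nonempty 0) (Seq (Push IDY True) (Seq (push_top 0 BITS) (Pop 0))) Skip) ?s1 5 ?s2"
    proof (rule run_If[where ?B1.0 = 4 and ?B2.0 = 1])
      assume "holds (Nonempty 0) ?s1"
      then have l: "k - Suc i < length D" by simp
      then have d: "drop (k - Suc i) D = D ! (k - Suc i) # drop (k - i) D"
        by (simp add: ki Cons_nth_drop_Suc)
      have t: "take (k - i) D = take (k - Suc i) D @ [D ! (k - Suc i)]"
        using l by (simp add: ki take_Suc_conv_app_nth)
      show "run (Seq (Push IDY True) (Seq (push_top 0 BITS) (Pop 0))) ?s1 4 ?s2"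
        apply (rule run_Seq[where ?B1.0 = 1 and ?B2.0 = 3])
          apply (rule run_Push[OF _ refl], simp)
         apply (rule run_Seq[where ?B1.0 = 2 and ?B2.0 = 1])
           apply (rule run_push_top[OF _ refl], simp)
          apply (rule run_Pop, simp)
        using l d t ki apply (auto simp: fun_eq_iff)
        done
    next
      assume "\<not> holds (Nonempty 0) ?s1"
      then have "length D \<le> k - Suc i" by simp
      then show "run Skip ?s1 1 ?s2"
        by (intro run_Skip) (auto simp: fun_eq_iff ki)
    qed auto
  qed auto
  have 2: "run (While (Top IDY) (Seq (Pop IDY) (Seq (push_top BITS 0) (Pop BITS))))
         ((?R ?m)(IDY := replicate ?m True @ False # ys)) (?m * (3 + 2) + 1)
         ((?R 0)(IDY := False # ys))"
  proof (rule run_countdown)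
    fix i assume i: "i < ?m"
    then have d: "drop i D = D ! i # drop (Suc i) D" and
       t: "take (Suc i) D = take i D @ [D ! i]"
      by (simp_all add: Cons_nth_drop_Suc take_Suc_conv_app_nth)
    show "run (Seq (push_top BITS 0) (Pop BITS)) ((?R (Suc i))(IDY := replicate i True @ False # ys))
           3 ((?R i)(IDY := replicate i True @ False # ys))"
      apply (rule run_Seq[where ?B1.0 = 2 and ?B2.0 = 1])
        apply (rule run_push_top[OF _ refl], simp)
       apply (rule run_Pop, simp)
      using d t apply (auto simp: fun_eq_iff)
      done
  qed auto
  have m: "drop ?m D = drop k D" "take ?m D = take k D" "?m \<le> k" by (auto simp: min_def)
  show ?thesis
    unfolding look_prog_def
    apply (rule run_Seq[where ?B1.0 = "7 * k + 1" and ?B2.0 = "5 * k + 5"])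
      apply (rule run_eq[OF run_mono])
        apply (rule back_subst[of "\<lambda>x. run _ x _ _", OF 1])
    using assms apply (auto simp: fun_eq_iff D_def)[1]
       apply simp
      apply (rule refl)
     apply (rule run_Seq[where ?B1.0 = 2 and ?B2.0 = "5 * k + 3"])
       apply (rule run_push_top[OF _ refl], simp)
      apply (rule run_Seq[where ?B1.0 = "5 * k + 1" and ?B2.0 = 2])
        apply (rule run_eq[OF run_mono])
          apply (rule back_subst[of "\<lambda>x. run _ x _ _", OF 2])
    using assms apply (auto simp: fun_eq_iff m)[1]
    using m(3) apply simp
        apply (rule refl)
       apply (rule run_Seq[where ?B1.0 = 1 and ?B2.0 = 1])
         apply (rule run_Pop[OF _ refl], simp)
        apply (rule run_Pop, simp)
        apply (auto simp: fun_eq_iff D_def)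
    done
qed

text \<open>Every expression leaves exactly one new bit on \<open>EV\<close>. Both sides of a
  disjunction are evaluated, and a quantifier is an iterated disjunction that starts from
  false.\<close>

fun bcomp :: "bexp \<Rightarrow> prog" where
  "bcomp (BConst b) = Push EV b"
| "bcomp (BLook e) = Seq (Push IDX False) (Seq (acomp IDX e) (Seq (Push IDY False) look_prog))"
| "bcomp (BLe e1 e2) = Seq (Push IDX False) (Seq (acomp IDX e1)
     (Seq (Push IDY False) (Seq (acomp IDY e2) le_prog)))"
| "bcomp (BNot b) = Seq (bcomp b)
     (If (Top EV) (Seq (Pop EV) (Push EV False)) (Seq (Pop EV) (Push EV True)))"
| "bcomp (BOr b1 b2) = Seq (bcomp b1) (Seq (bcomp b2)
     (If (Top EV) (Seq (Pop EV) (Seq (Pop EV) (Push EV True))) (Pop EV)))"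
| "bcomp (BEx r b) = Seq (Push EV False) (for_loop (reg r) (Seq (bcomp b)
     (If (Top EV) (Seq (Pop EV) (Seq (Pop EV) (Push EV True))) (Pop EV))))"

fun btime :: "bexp \<Rightarrow> nat poly" where
  "btime (BConst b) = [:1:]"
| "btime (BLook e) = atime e + smult 12 (amax e) + [:8:]"
| "btime (BLe e1 e2) = atime e1 + atime e2 + smult 4 (amax e2) + smult 3 (amax e1) + [:8:]"
| "btime (BNot b) = btime b + [:3:]"
| "btime (BOr b1 b2) = btime b1 + btime b2 + [:4:]"
| "btime (BEx r b) = pX * (btime b + [:13:]) + [:8:]"

lemma run_or:
  "s EV = b2 # b1 # xs \<Longrightarrow>
   run (If (Top EV) (Seq (Pop EV) (Seq (Pop EV) (Push EV True))) (Pop EV)) s 4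
     (s(EV := (b1 \<or> b2) # xs))"
  apply (rule run_If[where ?B1.0 = 3 and ?B2.0 = 1])
    apply (rule run_Seq[where ?B1.0 = 1 and ?B2.0 = 2])
      apply (rule run_Pop[OF _ refl], simp)
     apply (rule run_Seq[where ?B1.0 = 1 and ?B2.0 = 1])
       apply (rule run_Pop[OF _ refl], simp)
      apply (rule run_Push)
       apply (auto simp: fun_eq_iff)
  apply (rule run_Pop)
   apply (auto simp: fun_eq_iff)
  done

lemma run_bcomp:
  assumes "frame D n s"
  shows "run (bcomp b) s (poly (btime b) n) (s(EV := bval D n (env s) b # s EV))"
  using assms
proof (induction b arbitrary: s)
  case (BConst b)
  show ?case by (auto intro!: run_Push)
next
  case (BLook e)
  let ?k = "aval n (env s) e"
  let ?s1 = "s(IDX := replicate ?k True @ False # s IDX)"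
  have k: "?k \<le> poly (amax e) n"
    using BLook.prems by (intro aval_le_amax) (auto simp: frame_def)
  have D: "s 0 = D" using BLook.prems by (simp add: frame_def)
  show ?case
    apply (simp only: bcomp.simps)
    apply (rule run_Seq[where ?B1.0 = 1])
      apply (rule run_Push[OF _ refl], simp)
     apply (rule run_Seq[where ?s1.0 = ?s1])
       apply (rule run_eq[OF run_acomp[of D n]])
    using BLook.prems apply (auto simp: fun_eq_iff)[4]
      apply (rule run_Seq[where ?B1.0 = 1])
        apply (rule run_Push[OF _ refl], simp)
       apply (rule run_eq[OF run_look_prog[where k = ?k]])
         apply (auto simp: fun_eq_iff D)[3]
      apply (rule order_refl)
     apply (rule order_refl)
    using k apply simp
    done
next
  case (BLe e1 e2)
  let ?k = "aval n (env s) e1"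
  let ?l = "aval n (env s) e2"
  let ?s1 = "s(IDX := replicate ?k True @ False # s IDX)"
  let ?s2 = "?s1(IDY := replicate ?l True @ False # s IDY)"
  have k: "?k \<le> poly (amax e1) n" "?l \<le> poly (amax e2) n"
    using BLe.prems by (auto intro!: aval_le_amax simp: frame_def)
  show ?case
    apply (simp only: bcomp.simps)
    apply (rule run_Seq[where ?B1.0 = 1])
      apply (rule run_Push[OF _ refl], simp)
     apply (rule run_Seq[where ?s1.0 = ?s1])
       apply (rule run_eq[OF run_acomp[of D n]])
    using BLe.prems apply (auto simp: fun_eq_iff)[4]
      apply (rule run_Seq[where ?B1.0 = 1])
        apply (rule run_Push[OF _ refl], simp)
       apply (rule run_Seq[where ?s1.0 = ?s2])
         apply (rule run_eq[OF run_acomp[of D n]])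
    using BLe.prems apply (auto simp: fun_eq_iff)[4]
        apply (rule run_eq[OF run_le_prog[where a = ?k and b = ?l]])
          apply (auto simp: fun_eq_iff)[3]
       apply (rule order_refl)
      apply (rule order_refl)
     apply (rule order_refl)
    using k apply simp
    done
next
  case (BNot b)
  show ?case
    apply (simp only: bcomp.simps)
    apply (rule run_Seq[OF BNot.IH[OF BNot.prems], where ?B2.0 = 3])
     apply (rule run_If[where ?B1.0 = 2 and ?B2.0 = 2])
       apply (rule run_Seq[where ?B1.0 = 1 and ?B2.0 = 1])
         apply (rule run_Pop[OF _ refl], simp)
        apply (rule run_Push)
         apply (auto simp: fun_eq_iff)[3]
      apply (rule run_Seq[where ?B1.0 = 1 and ?B2.0 = 1])
        apply (rule run_Pop[OF _ refl], simp)
       apply (rule run_Push)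
        apply (auto simp: fun_eq_iff)
    done
next
  case (BOr b1 b2)
  show ?case
    apply (simp only: bcomp.simps)
    apply (rule run_Seq[OF BOr.IH(1)[OF BOr.prems]])
     apply (rule run_Seq[OF BOr.IH(2)])
    using BOr.prems apply (simp del: fun_upd_apply)
      apply (rule run_eq[OF run_or])
       apply (auto simp: fun_eq_iff simp flip: fun_upd_def)
    done
next
  case (BEx r b)
  let ?P = "\<lambda>i. bval D n ((env s)(r := i)) b"
  \<comment> \<open>The loop counts down, so when \<open>i\<close> passes remain the values from
    \<open>i\<close> to \<open>n - 1\<close> have been tested.\<close>
  let ?Q = "\<lambda>i. s(EV := (\<exists>j<n. i \<le> j \<and> ?P j) # s EV)"
  have n: "uval (s 0) = n" using BEx.prems by (simp add: frame_def)
  have "run (for_loop (reg r) (Seq (bcomp b)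
     (If (Top EV) (Seq (Pop EV) (Seq (Pop EV) (Push EV True))) (Pop EV))))
     (s(EV := False # s EV)) (n * ((poly (btime b) n + 4) + 9) + 7) ((?Q 0)(reg r := (s(EV := False # s EV)) (reg r)))"
  proof (rule run_for_loop)
    fix i assume i: "i < n"
    let ?t = "(?Q (Suc i))(reg r := replicate i True @ False # (s(EV := False # s EV)) (reg r))"
    have e: "env ?t = (env s)(r := i)" by (simp add: env_def fun_eq_iff)
    have f: "frame D n ?t" by (rule frame_reg) (use i BEx.prems in auto)
    have *: "(\<exists>j<n. i \<le> j \<and> ?P j) = ((\<exists>j<n. Suc i \<le> j \<and> ?P j) \<or> ?P i)"
      using i by (metis Suc_le_eq le_eq_less_or_eq)
    show "run (Seq (bcomp b) (If (Top EV) (Seq (Pop EV) (Seq (Pop EV) (Push EV True))) (Pop EV)))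
       ?t (poly (btime b) n + 4)
       ((?Q i)(reg r := replicate i True @ False # (s(EV := False # s EV)) (reg r)))"
      apply (rule run_Seq[OF BEx.IH[OF f] run_eq[OF run_or]])
      unfolding e * by (auto simp: fun_eq_iff simp flip: fun_upd_def)
  qed (use n in \<open>auto simp: fun_eq_iff\<close>)
  then show ?case
    apply (simp only: bcomp.simps)
    apply (rule run_Seq[where ?B1.0 = 1])
      apply (rule run_Push[OF _ refl], simp)
     apply (rule run_eq)
      apply assumption
    by (auto simp: fun_eq_iff)
qed

section \<open>Generators of bit strings\<close>

text \<open>All loops run over the numbers below \<open>n\<close>, and their nesting depth is fixed
  by the expression; hence the polynomial time bound.\<close>

datatype gen = GBits "bool list" | GUnary aexp | GSeq gen gen | GFor nat gen | GIf bexp gen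

fun gval :: "bool list \<Rightarrow> nat \<Rightarrow> (nat \<Rightarrow> nat) \<Rightarrow> gen \<Rightarrow> bool list" where
  "gval D n w (GBits bs) = bs"
| "gval D n w (GUnary e) = replicate (aval n w e) True"
| "gval D n w (GSeq g1 g2) = gval D n w g1 @ gval D n w g2"
| "gval D n w (GFor r g) = concat (map (\<lambda>i. gval D n (w(r := i)) g) [0..<n])"
| "gval D n w (GIf b g) = (if bval D n w b then gval D n w g else [])"

fun push_bits :: "bool list \<Rightarrow> prog" where
  "push_bits [] = Skip"
| "push_bits (b # bs) = Seq (push_bits bs) (Push 1 b)"

text \<open>The first output bit must end up on top of the stack, so the second part of a sequence
  is generated before the first.\<close>

fun gcomp :: "gen \<Rightarrow> prog" where
  "gcomp (GBits bs) = push_bits bs"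
| "gcomp (GUnary e) = acomp 1 e"
| "gcomp (GSeq g1 g2) = Seq (gcomp g2) (gcomp g1)"
| "gcomp (GFor r g) = for_loop (reg r) (gcomp g)"
| "gcomp (GIf b g) = Seq (bcomp b) (If (Top EV) (Seq (Pop EV) (gcomp g)) (Pop EV))"

fun gtime :: "gen \<Rightarrow> nat poly" where
  "gtime (GBits bs) = [:length bs + 1:]"
| "gtime (GUnary e) = atime e"
| "gtime (GSeq g1 g2) = gtime g1 + gtime g2"
| "gtime (GFor r g) = pX * (gtime g + [:9:]) + [:7:]"
| "gtime (GIf b g) = btime b + gtime g + [:2:]"

lemma run_push_bits: "run (push_bits bs) s (length bs + 1) (s(1 := bs @ s 1))"
proof (induction bs)
  case Nil
  then show ?case by (auto intro: run_Skip)
next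
  case (Cons b bs)
  show ?case
    apply (simp only: push_bits.simps)
    apply (rule run_Seq[OF Cons, where ?B2.0 = 1])
     apply (rule run_Push)
      apply (auto simp: fun_eq_iff)
    done
qed

lemma run_gcomp:
  assumes "frame D n s"
  shows "run (gcomp g) s (poly (gtime g) n) (s(1 := gval D n (env s) g @ s 1))"
  using assms
proof (induction g arbitrary: s)
  case (GBits bs)
  show ?case using run_push_bits[of bs s] by (simp del: fun_upd_apply)
next
  case (GUnary e)
  then have "run (acomp 1 e) s (poly (atime e) n) (s(1 := replicate (aval n (env s) e) True @ s 1))"
    by (intro run_acomp[of D]) auto
  then show ?case by (simp del: fun_upd_apply)
next
  case (GSeq g1 g2)
  show ?case
    apply (simp only: gcomp.simps)
    apply (rule run_Seq[OF GSeq.IH(2)[OF GSeq.prems] run_eq[OF GSeq.IH(1)]])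
    using GSeq.prems by (auto simp del: fun_upd_apply simp: fun_upd_same)
next
  case (GFor r g)
  let ?f = "\<lambda>i. gval D n ((env s)(r := i)) g"
  let ?Q = "\<lambda>i. s(1 := concat (map ?f [i..<n]) @ s 1)"
  have n: "uval (s 0) = n" using GFor.prems by (simp add: frame_def)
  have "run (for_loop (reg r) (gcomp g)) s (n * (poly (gtime g) n + 9) + 7) ((?Q 0)(reg r := s (reg r)))"
  proof (rule run_for_loop)
    fix i assume i: "i < n"
    let ?t = "(?Q (Suc i))(reg r := replicate i True @ False # s (reg r))"
    have e: "env ?t = (env s)(r := i)" by (simp add: env_def fun_eq_iff)
    have f: "frame D n ?t" by (rule frame_reg) (use i GFor.prems in auto)
    have *: "[i..<n] = i # [Suc i..<n]" using i by (simp add: upt_conv_Cons)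
    show "run (gcomp g) ?t (poly (gtime g) n)
       ((?Q i)(reg r := replicate i True @ False # s (reg r)))"
      apply (rule run_eq[OF GFor.IH[OF f]])
      unfolding e * by (auto simp: fun_eq_iff simp flip: fun_upd_def)
  qed (use n in \<open>auto simp: fun_eq_iff\<close>)
  then show ?case
    unfolding gcomp.simps by (rule run_eq[OF run_mono]) (auto simp: fun_eq_iff)
next
  case (GIf b g)
  show ?case
    apply (simp only: gcomp.simps)
    apply (rule run_Seq[OF run_bcomp[OF GIf.prems], where ?B2.0 = "poly (gtime g) n + 2"])
     apply (rule run_If[where ?B1.0 = "poly (gtime g) n + 1" and ?B2.0 = 1])
       apply (rule run_Seq[where ?B1.0 = 1])
         apply (rule run_Pop[OF _ refl], simp)
        apply (rule run_eq[OF GIf.IH])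
    using GIf.prems apply (auto simp: fun_eq_iff)[4]
     apply (rule run_Pop)
      apply (auto simp: fun_eq_iff)
    done
qed

lemma poly_nat_mono: "x \<le> y \<Longrightarrow> poly p x \<le> poly p (y :: nat)"
  by (induction p) (auto intro!: add_mono mult_mono)

text \<open>Program and polynomial depend on \<open>g\<close> alone. The bound is polynomial in the
  leading block of ones of the input, which is no longer than the input itself.\<close>

lemma poly_time_computable_gval:
  assumes "\<And>x. x \<in> S \<Longrightarrow> enc_out (f x) = gval (enc_in x) (uval (enc_in x)) (\<lambda>_. 0) g"
  shows "poly_time_computable S enc_in enc_out f"
  unfolding poly_time_computable_def
proof (rule exI[of _ "gcomp g"], rule exI[of _ "gtime g"], rule ballI)
  fix x assume x: "x \<in> S"
  let ?s = "(\<lambda>_. [])(0 := enc_in x)"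
  let ?n = "uval (enc_in x)"
  have "env ?s = (\<lambda>_. 0)" by (simp add: env_def fun_eq_iff)
  moreover from this have "frame (enc_in x) ?n ?s" by (simp add: frame_def)
  ultimately have "run (gcomp g) ?s (poly (gtime g) ?n) (?s(1 := enc_out (f x)))"
    using run_gcomp[of "enc_in x" ?n ?s g] by (simp add: assms x)
  then obtain t where t: "t \<le> poly (gtime g) ?n" "exec (gcomp g) ?s t (?s(1 := enc_out (f x)))"
    unfolding run_def by blast
  have "?n \<le> length (enc_in x)" by (simp add: uval_def length_takeWhile_le)
  with t(1) have "t \<le> poly (gtime g) (length (enc_in x))"
    using poly_nat_mono le_trans by blast
  with t(2) show "\<exists>t s. exec (gcomp g) ?s t s \<and> s 1 = enc_out (f x) \<and>
     t \<le> poly (gtime g) (length (enc_in x))" by fastforce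
qed

section \<open>Formula templates\<close>

text \<open>A clause template \<open>(rs, b, ls)\<close> is instantiated once for each assignment of values below \<open>n\<close> to
  the registers \<open>rs\<close> that satisfies \<open>b\<close>; a disjunct template is treated likewise.\<close>

type_synonym clause_template = "nat list \<times> bexp \<times> (bool \<times> aexp) list"
type_synonym disjunct_template = "nat list \<times> clause_template list"
type_synonym template = "disjunct_template list"

fun envs :: "nat \<Rightarrow> nat list \<Rightarrow> (nat \<Rightarrow> nat) \<Rightarrow> (nat \<Rightarrow> nat) list" where
  "envs n [] w = [w]"
| "envs n (r # rs) w = concat (map (\<lambda>i. envs n rs (w(r := i))) [0..<n])"

fun inst_lit :: "nat \<Rightarrow> (nat \<Rightarrow> nat) \<Rightarrow> bool \<times> aexp \<Rightarrow> plit" where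
  "inst_lit n w (b, e) = (if b then PPos else PNeg) (aval n w e)"

fun inst_clause :: "bool list \<Rightarrow> nat \<Rightarrow> (nat \<Rightarrow> nat) \<Rightarrow> clause_template \<Rightarrow> pcnf" where
  "inst_clause D n w (rs, b, ls) =
     concat (map (\<lambda>w'. if bval D n w' b then [map (inst_lit n w') ls] else []) (envs n rs w))"

fun inst_disjunct :: "bool list \<Rightarrow> nat \<Rightarrow> (nat \<Rightarrow> nat) \<Rightarrow> disjunct_template \<Rightarrow> pformula" where
  "inst_disjunct D n w (rs, cts) =
     map (\<lambda>w'. concat (map (inst_clause D n w') cts)) (envs n rs w)"

definition inst :: "bool list \<Rightarrow> nat \<Rightarrow> (nat \<Rightarrow> nat) \<Rightarrow> template \<Rightarrow> pformula" where
  "inst D n w tm = concat (map (inst_disjunct D n w) tm)"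

subsection \<open>Generating the encoding\<close>

text \<open>This is \<open>enc_list\<close> without the end marker. It maps concatenation to
  concatenation, as is needed for output that is assembled by nested loops.\<close>

definition enc_items :: "('b \<Rightarrow> bool list) \<Rightarrow> 'b list \<Rightarrow> bool list" where
  "enc_items enc xs = concat (map (\<lambda>x. True # enc x) xs)"

lemma enc_list_items: "enc_list enc xs = enc_items enc xs @ [False]"
  by (simp add: enc_list_def enc_items_def)

lemma enc_items_simps [simp]:
  "enc_items enc [] = []" "enc_items enc (x # xs) = True # enc x @ enc_items enc xs"
  "enc_items enc (xs @ ys) = enc_items enc xs @ enc_items enc ys"
  by (simp_all add: enc_items_def)

lemma enc_items_concat: "enc_items enc (concat xss) = concat (map (enc_items enc) xss)"
  by (induction xss) auto

fun gfors :: "nat list \<Rightarrow> gen \<Rightarrow> gen" where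
  "gfors [] g = g"
| "gfors (r # rs) g = GFor r (gfors rs g)"

fun gseqs :: "gen list \<Rightarrow> gen" where
  "gseqs [] = GBits []"
| "gseqs (g # gs) = GSeq g (gseqs gs)"

fun glit :: "bool \<times> aexp \<Rightarrow> gen" where
  "glit (b, e) = gseqs [GBits [True, b], GUnary e, GBits [False]]"

fun gclause :: "clause_template \<Rightarrow> gen" where
  "gclause (rs, b, ls) =
     gfors rs (GIf b (gseqs [GBits [True], gseqs (map glit ls), GBits [False]]))"

fun gdisjunct :: "disjunct_template \<Rightarrow> gen" where
  "gdisjunct (rs, cts) = gfors rs (gseqs [GBits [True], gseqs (map gclause cts), GBits [False]])"

definition gformula :: "template \<Rightarrow> gen" where
  "gformula tm = gseqs [gseqs (map gdisjunct tm), GBits [False]]"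

lemma concat_concat_map:
  "concat (concat (map f xs)) = concat (map (\<lambda>x. concat (f x)) xs)"
  by (induction xs) auto

lemma gval_gfors: "gval D n w (gfors rs g) = concat (map (\<lambda>w'. gval D n w' g) (envs n rs w))"
  by (induction rs arbitrary: w) (auto simp: map_concat concat_concat_map o_def)

lemma gval_gseqs: "gval D n w (gseqs gs) = concat (map (gval D n w) gs)"
  by (induction gs) auto

lemma gval_glit: "gval D n w (glit l) = True # enc_plit (inst_lit n w l)"
  by (cases l) auto

lemma gval_gclause: "gval D n w (gclause ct) = enc_items (enc_list enc_plit) (inst_clause D n w ct)"
proof (cases ct)
  case (fields rs b ls)
  have "gval D n w' (gseqs (map glit ls)) = enc_items enc_plit (map (inst_lit n w') ls)" for w'
    by (simp add: gval_gseqs gval_glit enc_items_def o_def)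
  then show ?thesis
    by (auto simp: fields gval_gfors enc_items_concat enc_list_items o_def
        intro!: arg_cong[where f = concat])
qed

lemma gval_gdisjunct:
  "gval D n w (gdisjunct dt) = enc_items (enc_list (enc_list enc_plit)) (inst_disjunct D n w dt)"
proof (cases dt)
  case (Pair rs cts)
  have "gval D n w' (gseqs (map gclause cts)) =
      enc_items (enc_list enc_plit) (concat (map (inst_clause D n w') cts))" for w'
    by (simp add: gval_gseqs gval_gclause enc_items_concat o_def)
  then show ?thesis
    by (auto simp: Pair gval_gfors enc_list_items enc_items_def[of _ "map _ _"] o_def)
qed

lemma gval_gformula: "gval D n w (gformula tm) = enc_pformula (inst D n w tm)"
  by (simp add: gformula_def gval_gseqs gval_gdisjunct inst_def enc_pformula_def
      enc_list_items enc_items_concat o_def)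

subsection \<open>Satisfaction and variables\<close>

fun sat_ct :: "bool list \<Rightarrow> nat \<Rightarrow> nat set \<Rightarrow> (nat \<Rightarrow> nat) \<Rightarrow> clause_template \<Rightarrow> bool" where
  "sat_ct D n T w (rs, b, ls) \<longleftrightarrow> (\<forall>w' \<in> set (envs n rs w). bval D n w' b \<longrightarrow>
     (\<exists>(s, e) \<in> set ls. (aval n w' e \<in> T) = s))"

definition sat_template :: "bool list \<Rightarrow> nat \<Rightarrow> nat set \<Rightarrow> (nat \<Rightarrow> nat) \<Rightarrow> template \<Rightarrow> bool" where
  "sat_template D n T w tm \<longleftrightarrow> (\<exists>(rs, cts) \<in> set tm. \<exists>w' \<in> set (envs n rs w).
     \<forall>ct \<in> set cts. sat_ct D n T w' ct)"

fun ct_vars :: "bool list \<Rightarrow> nat \<Rightarrow> (nat \<Rightarrow> nat) \<Rightarrow> clause_template \<Rightarrow> nat set" where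
  "ct_vars D n w (rs, b, ls) =
     (\<Union>w' \<in> {w' \<in> set (envs n rs w). bval D n w' b}. (\<lambda>(s, e). aval n w' e) ` set ls)"

lemma sat_plit_inst_lit: "sat_plit T (inst_lit n w (s, e)) \<longleftrightarrow> (aval n w e \<in> T) = s"
  by auto

lemma pvar_inst_lit: "pvar (inst_lit n w (s, e)) = aval n w e"
  by auto

lemma sat_inst_clause:
  "(\<forall>C \<in> set (inst_clause D n w ct). \<exists>l \<in> set C. sat_plit T l) \<longleftrightarrow> sat_ct D n T w ct"
proof (cases ct)
  case (fields rs b ls)
  have "(\<exists>l \<in> set (map (inst_lit n w') ls). sat_plit T l) \<longleftrightarrow>
      (\<exists>(s, e) \<in> set ls. (aval n w' e \<in> T) = s)" for w'
    by (auto simp del: inst_lit.simps simp: sat_plit_inst_lit split_beta) force+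
  then show ?thesis
    by (auto simp: fields split: if_splits)
qed

lemma vars_inst_clause:
  "(\<Union>C \<in> set (inst_clause D n w ct). pvar ` set C) = ct_vars D n w ct"
proof (cases ct)
  case (fields rs b ls)
  have "pvar ` set (map (inst_lit n w') ls) = (\<lambda>(s, e). aval n w' e) ` set ls" for w'
    by (force simp del: inst_lit.simps simp: pvar_inst_lit image_image)
  then show ?thesis
    by (auto simp: fields split: if_splits)
qed

lemma set_inst:
  "G \<in> set (inst D n w tm) \<longleftrightarrow>
   (\<exists>(rs, cts) \<in> set tm. \<exists>w' \<in> set (envs n rs w). G = concat (map (inst_clause D n w') cts))"
  unfolding inst_def by force

lemma sat_pformula_inst: "sat_pformula T (inst D n w tm) \<longleftrightarrow> sat_template D n T w tm"
proof -
  let ?Q = "\<lambda>G. \<forall>C \<in> set G. \<exists>l \<in> set C. sat_plit T l"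
  have "?Q (concat (map (inst_clause D n w') cts)) \<longleftrightarrow> (\<forall>ct \<in> set cts. sat_ct D n T w' ct)" for w' cts
    by (simp only: sat_inst_clause[symmetric] set_concat set_map) blast
  moreover have "(\<exists>G \<in> set (inst D n w tm). ?Q G) \<longleftrightarrow> (\<exists>(rs, cts) \<in> set tm.
      \<exists>w' \<in> set (envs n rs w). ?Q (concat (map (inst_clause D n w') cts)))"
    unfolding Bex_def set_inst split_beta by blast
  ultimately show ?thesis
    unfolding sat_pformula_def sat_template_def by presburger
qed

text \<open>If all disjuncts have the same variables, then no special treatment of the empty disjunction is
  needed, although it has no variables.\<close>

lemma count_disj2sat_inst:
  assumes "\<And>rs cts w'. (rs, cts) \<in> set tm \<Longrightarrow> w' \<in> set (envs n rs w) \<Longrightarrow>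
    (\<Union>ct \<in> set cts. ct_vars D n w' ct) = P"
  shows "count_disj2sat (inst D n w tm) = card {T. T \<subseteq> P \<and> sat_template D n T w tm}"
proof -
  have G: "(\<Union>C \<in> set G. pvar ` set C) = P" if "G \<in> set (inst D n w tm)" for G
  proof -
    from that obtain rs cts w' where *: "(rs, cts) \<in> set tm" "w' \<in> set (envs n rs w)"
      "G = concat (map (inst_clause D n w') cts)"
      unfolding set_inst by blast
    have "(\<Union>C \<in> set G. pvar ` set C) = (\<Union>ct \<in> set cts. ct_vars D n w' ct)"
      unfolding *(3) vars_inst_clause[symmetric] by auto
    with assms[OF *(1,2)] show ?thesis by simp
  qed
  show ?thesis
  proof (cases "inst D n w tm = []")
    case True
    then have "\<not> sat_template D n T w tm" for T
      unfolding sat_pformula_inst[symmetric] by (simp add: sat_pformula_def)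
    then show ?thesis
      unfolding count_disj2sat_def sat_pformula_inst by simp
  next
    case False
    then have "pvars (inst D n w tm) = P"
      unfolding pvars_def using G by simp
    then show ?thesis
      unfolding count_disj2sat_def sat_pformula_inst by simp
  qed
qed

lemma inst_disj2sat:
  assumes "\<And>rs cts rs' b ls. (rs, cts) \<in> set tm \<Longrightarrow> (rs', b, ls) \<in> set cts \<Longrightarrow> length ls \<le> 2"
  shows "inst D n w tm \<in> disj2sat"
  unfolding disj2sat_def
proof (clarify)
  fix G C assume "G \<in> set (inst D n w tm)" and C: "C \<in> set G"
  then obtain rs cts w' where *: "(rs, cts) \<in> set tm"
      "G = concat (map (inst_clause D n w') cts)"
    unfolding set_inst by blast
  with C obtain rs' b ls where ct: "(rs', b, ls) \<in> set cts" "C \<in> set (inst_clause D n w' (rs', b, ls))"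
    by auto
  from ct(2) have "length C = length ls" by (auto split: if_splits)
  with assms[OF *(1) ct(1)] show "length C \<le> 2" by simp
qed

lemma envs_other: "w' \<in> set (envs n rs w) \<Longrightarrow> r \<notin> set rs \<Longrightarrow> w' r = w r"
  by (induction rs arbitrary: w) fastforce+

lemma envs_tuples:
  "distinct rs \<Longrightarrow> (\<lambda>w'. map w' rs) ` set (envs n rs w) = tuples {..<n} (length rs)"
proof (induction rs arbitrary: w)
  case Nil
  then show ?case by (auto simp: tuples_def)
next
  case (Cons r rs)
  have r: "w' r = i" if "w' \<in> set (envs n rs (w(r := i)))" for w' i
    using envs_other[OF that, of r] Cons.prems by simp
  have "(\<lambda>w'. map w' (r # rs)) ` set (envs n (r # rs) w) =
      (\<Union>i<n. (\<lambda>w'. w' r # map w' rs) ` set (envs n rs (w(r := i))))"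
    by (simp add: image_UN atLeast0LessThan)
  also have "\<dots> = (\<Union>i<n. (#) i ` (\<lambda>w'. map w' rs) ` set (envs n rs (w(r := i))))"
    unfolding image_image using r by (intro SUP_cong refl image_cong) auto
  also have "\<dots> = (\<Union>i<n. (#) i ` tuples {..<n} (length rs))"
    using Cons by simp
  also have "\<dots> = tuples {..<n} (length (r # rs))"
    by (auto simp: tuples_def length_Suc_conv image_iff)
  finally show ?case .
qed

section \<open>Codes of tuples\<close>

text \<open>The number with digits \<open>ts\<close> in base \<open>n\<close>, most significant
  first. For digits below \<open>n\<close> it is also the position of \<open>ts\<close> in the
  lexicographic list of tuples of its length, so it serves both for numbering variables and for
  finding table entries.\<close>

fun horner :: "nat \<Rightarrow> nat list \<Rightarrow> nat" where
  "horner n [] = 0"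
| "horner n (t # ts) = t * n ^ length ts + horner n ts"

text \<open>The tuple \<open>ts\<close> is meant to have at most \<open>K\<close> elements below \<open>n\<close>, so that \<open>horner n ts < n ^ K\<close>.\<close>

definition code :: "nat \<Rightarrow> nat \<Rightarrow> nat \<Rightarrow> nat list \<Rightarrow> nat" where
  "code n K j ts = j * n ^ K + horner n ts"

lemma horner_less: "set ts \<subseteq> {..<n} \<Longrightarrow> horner n ts < n ^ length ts"
proof (induction ts)
  case (Cons t ts)
  then have "t * n ^ length ts + horner n ts < (t + 1) * n ^ length ts" by simp
  also have "\<dots> \<le> n * n ^ length ts" using Cons.prems by (intro mult_right_mono) auto
  finally show ?case by simp
qed simp

lemma mult_add_cancel:
  assumes "a * m + b = a' * m + b'" "b < m" "b' < (m :: nat)"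
  shows "a = a' \<and> b = b'"
proof -
  have "(a * m + b) div m = a" "(a' * m + b') div m = a'" using assms(2,3) by auto
  with assms(1) show ?thesis by simp
qed

lemma horner_inj:
  "length ts = length us \<Longrightarrow> set ts \<subseteq> {..<n} \<Longrightarrow> set us \<subseteq> {..<n} \<Longrightarrow> horner n ts = horner n us
   \<Longrightarrow> ts = us"
proof (induction ts us rule: list_induct2)
  case (Cons t ts u us)
  then show ?case
    using mult_add_cancel[of t "n ^ length ts" "horner n ts" u "horner n us"]
      horner_less[of ts n] horner_less[of us n] by auto
qed simp

text \<open>Block number and digits are quotient and remainder modulo \<open>n ^ K\<close>. Leading
  zeros are invisible in a number, so equality of the tuples is claimed only for equal
  lengths.\<close>

lemma code_inj:
  assumes "ts \<in> tuples {..<n} k" "us \<in> tuples {..<n} l" "k \<le> K" "l \<le> K" "n \<noteq> 0"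
    and "code n K i ts = code n K j us"
  shows "i = j \<and> (k = l \<longrightarrow> ts = us)"
proof -
  have "horner n ts < n ^ K" "horner n us < n ^ K"
    using horner_less[of ts n] horner_less[of us n] assms power_increasing[of k K n]
      power_increasing[of l K n]
    by (auto simp: tuples_def)
  with assms(6) have *: "i = j \<and> horner n ts = horner n us"
    unfolding code_def by (intro mult_add_cancel) auto
  with horner_inj[of ts us n] assms(1,2) show ?thesis by (auto simp: tuples_def)
qed

text \<open>The propositional variables of one binder or selector: \<open>k\<close> is 0 for
  selectors, 1 for first-order variables, and the arity for second-order variables.\<close>

definition block :: "nat \<Rightarrow> nat \<Rightarrow> nat \<Rightarrow> nat \<Rightarrow> nat set" where
  "block n K j k = code n K j ` tuples {..<n} k"

lemma code_in_block: "ts \<in> tuples {..<n} k \<Longrightarrow> code n K j ts \<in> block n K j k"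
  by (simp add: block_def)

lemma finite_tuples: "finite U \<Longrightarrow> finite (tuples U k)"
  using finite_lists_length_eq[of U k] by (simp add: tuples_def conj_commute)

lemma finite_block: "finite (block n K j k)"
  by (simp add: block_def finite_tuples)

lemma block_disjoint:
  "n \<noteq> 0 \<Longrightarrow> k \<le> K \<Longrightarrow> l \<le> K \<Longrightarrow> i \<noteq> j \<Longrightarrow> block n K i k \<inter> block n K j l = {}"
  unfolding block_def using code_inj by blast

lemma tuples_0: "tuples U 0 = {[]}"
  by (auto simp: tuples_def)

lemma tuples_1: "tuples U (Suc 0) = (\<lambda>x. [x]) ` U"
  by (auto simp: tuples_def length_Suc_conv)

section \<open>Reading the encoding of a structure\<close>

lemma nth_concat_const:
  assumes "\<And>x. x \<in> set xs \<Longrightarrow> length (f x) = m" "i < length xs" "h < m"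
  shows "concat (map f xs) ! (i * m + h) = f (xs ! i) ! h"
  using assms
proof (induction xs arbitrary: i)
  case (Cons x xs)
  show ?case
  proof (cases i)
    case 0
    then show ?thesis using Cons.prems by (simp add: nth_append)
  next
    case (Suc i')
    then show ?thesis using Cons.prems Cons.IH[of i'] by (simp add: nth_append add.assoc)
  qed
qed simp

lemma length_product_lists_replicate: "length (product_lists (replicate k us)) = length us ^ k"
  by (induction k) (auto simp: length_concat o_def sum_list_triv)

text \<open>In lexicographic order the first component selects a segment of length
  \<open>n ^ length ts\<close>, and the remaining components give the position within it.\<close>

lemma nth_product_lists:
  "set ts \<subseteq> {..<length us} \<Longrightarrow>
   product_lists (replicate (length ts) us) ! horner (length us) ts = map ((!) us) ts"
proof (induction ts)
  case (Cons t ts)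
  let ?P = "product_lists (replicate (length ts) us)"
  let ?n = "length us"
  have h: "horner ?n ts < ?n ^ length ts" using Cons.prems by (intro horner_less) auto
  have "concat (map (\<lambda>x. map ((#) x) ?P) us) ! (t * ?n ^ length ts + horner ?n ts) =
      map ((#) (us ! t)) ?P ! horner ?n ts"
    by (rule nth_concat_const) (use Cons.prems h in \<open>auto simp: length_product_lists_replicate\<close>)
  also have "\<dots> = us ! t # ?P ! horner ?n ts"
    using h by (simp add: length_product_lists_replicate)
  finally show ?case using Cons by simp
qed simp

lemma drop_concat:
  "i < length xss \<Longrightarrow> h \<le> length (xss ! i) \<Longrightarrow>
   drop (sum_list (map length (take i xss)) + h) (concat xss) =
   drop h (xss ! i) @ concat (drop (Suc i) xss)"
proof (induction xss arbitrary: i)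
  case (Cons xs xss)
  then show ?case by (cases i) (auto simp: add.assoc)
qed simp

lemma top_bit_drop: "h < length xs \<Longrightarrow> top_bit (drop h xs @ ys) = xs ! h"
  by (simp flip: Cons_nth_drop_Suc)

section \<open>Translation of sentences into templates\<close>

fun horner_exp :: "nat list \<Rightarrow> aexp" where
  "horner_exp [] = ANum 0"
| "horner_exp (r # rs) = AAdd ((ATimesN ^^ length rs) (AVar r)) (horner_exp rs)"

definition code_exp :: "nat \<Rightarrow> nat \<Rightarrow> nat list \<Rightarrow> aexp" where
  "code_exp K j rs = AAdd ((ATimesN ^^ K) (ANum j)) (horner_exp rs)"

lemma aval_ATimesN_pow: "aval n w ((ATimesN ^^ k) e) = n ^ k * aval n w e"
  by (induction k) auto

lemma aval_horner_exp: "aval n w (horner_exp rs) = horner n (map w rs)"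
  by (induction rs) (auto simp: aval_ATimesN_pow)

lemma aval_code_exp: "aval n w (code_exp K j rs) = code n K j (map w rs)"
  by (simp add: code_exp_def code_def aval_ATimesN_pow aval_horner_exp)

text \<open>The total length of the characteristic strings of relations with arities
  \<open>ks\<close>.\<close>

fun offset_exp :: "nat list \<Rightarrow> aexp" where
  "offset_exp [] = ANum 0"
| "offset_exp (k # ks) = AAdd ((ATimesN ^^ k) (ANum 1)) (offset_exp ks)"

lemma aval_offset_exp: "aval n w (offset_exp ks) = sum_list (map ((^) n) ks)"
  by (induction ks) (auto simp: aval_ATimesN_pow)

text \<open>The summand \<open>n + 1\<close> skips the unary size and the zero after it; then come
  the strings of the preceding relations.\<close>

definition rel_exp :: "vocabulary \<Rightarrow> nat \<Rightarrow> nat list \<Rightarrow> aexp" where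
  "rel_exp \<sigma> i rs = AAdd (AAdd (ATimesN (ANum 1)) (ANum 1))
     (AAdd (offset_exp (take i \<sigma>)) (horner_exp rs))"

definition BEq :: "aexp \<Rightarrow> aexp \<Rightarrow> bexp" where
  "BEq a b = BNot (BOr (BNot (BLe a b)) (BNot (BLe b a)))"

lemma bval_BEq [simp]: "bval D n w (BEq a b) \<longleftrightarrow> aval n w a = aval n w b"
  by (auto simp: BEq_def)

text \<open>First-order variables are held in registers given by \<open>\<rho>\<close>; the registers from \<open>m\<close> on are
  free. This renaming takes care of variables that are bound more than once.\<close>

fun fo_bexp :: "vocabulary \<Rightarrow> (fovar \<Rightarrow> nat) \<Rightarrow> nat \<Rightarrow> fo \<Rightarrow> bexp" where
  "fo_bexp \<sigma> \<rho> m (FEq x y) = BEq (AVar (\<rho> x)) (AVar (\<rho> y))"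
| "fo_bexp \<sigma> \<rho> m (FRel i xs) = BLook (rel_exp \<sigma> i (map \<rho> xs))"
| "fo_bexp \<sigma> \<rho> m (FNot \<phi>) = BNot (fo_bexp \<sigma> \<rho> m \<phi>)"
| "fo_bexp \<sigma> \<rho> m (FOr \<phi> \<psi>) = BOr (fo_bexp \<sigma> \<rho> m \<phi>) (fo_bexp \<sigma> \<rho> m \<psi>)"
| "fo_bexp \<sigma> \<rho> m (FEx x \<phi>) = BEx m (fo_bexp \<sigma> (\<rho>(x := m)) (Suc m) \<phi>)"
| "fo_bexp \<sigma> \<rho> m FTrue = BConst True"
| "fo_bexp \<sigma> \<rho> m FFalse = BConst False"

fun disjunct_guard :: "vocabulary \<Rightarrow> (fovar \<Rightarrow> nat) \<Rightarrow> nat \<Rightarrow> disjunct \<Rightarrow> bexp" where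
  "disjunct_guard \<sigma> \<rho> m (FO \<phi>) = fo_bexp \<sigma> \<rho> m \<phi>"
| "disjunct_guard \<sigma> \<rho> m _ = BConst False"

fun disjunct_lits :: "nat \<Rightarrow> (fovar \<Rightarrow> nat) \<Rightarrow> (sovar \<Rightarrow> nat) \<Rightarrow> disjunct \<Rightarrow> (bool \<times> aexp) list" where
  "disjunct_lits K \<rho> \<eta> (Pos X xs) = [(True, code_exp K (\<eta> X) (map \<rho> xs))]"
| "disjunct_lits K \<rho> \<eta> (Neg X xs) = [(False, code_exp K (\<eta> X) (map \<rho> xs))]"
| "disjunct_lits K \<rho> \<eta> (FO \<phi>) = []"

text \<open>A clause is emitted exactly where its first-order disjuncts are all false, and there its
  literals alone decide. A clause without literals then becomes the empty clause, which is false as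
  it should be.\<close>

fun clause_ct ::
  "vocabulary \<Rightarrow> nat \<Rightarrow> (fovar \<Rightarrow> nat) \<Rightarrow> (sovar \<Rightarrow> nat) \<Rightarrow> nat \<Rightarrow> nat list \<Rightarrow> clause \<Rightarrow> clause_template"
  where
  "clause_ct \<sigma> K \<rho> \<eta> m rs (Clause d1 d2 d3) =
     (rs, BNot (BOr (disjunct_guard \<sigma> \<rho> m d1) (BOr (disjunct_guard \<sigma> \<rho> m d2) (disjunct_guard \<sigma> \<rho> m d3))),
      disjunct_lits K \<rho> \<eta> d1 @ disjunct_lits K \<rho> \<eta> d2 @ disjunct_lits K \<rho> \<eta> d3)"

text \<open>The registers from 0 on may belong to outer binders. Overwriting them is safe, because
  the clause reads only registers set by its own loops.\<close>

definition all_ct :: "nat \<Rightarrow> bool \<Rightarrow> nat \<Rightarrow> nat \<Rightarrow> clause_template" where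
  "all_ct K b j k = ([0..<k], BConst True, [(b, code_exp K j [0..<k])])"

text \<open>Tautologies: they impose nothing, but make every variable of the block occur and thus be
  counted.\<close>

definition free_ct :: "nat \<Rightarrow> nat \<Rightarrow> nat \<Rightarrow> clause_template" where
  "free_ct K j k =
     ([0..<k], BConst True, [(True, code_exp K j [0..<k]), (False, code_exp K j [0..<k])])"

text \<open>Register \<open>j\<close> holds the chosen value and \<open>Suc j\<close> runs through
  all values, giving one unit clause per variable. \<open>Suc j\<close> may also be a register of an
  inner binder, but its value there is not read by these clauses.\<close>

definition onehot_cts :: "nat \<Rightarrow> nat \<Rightarrow> clause_template list" where
  "onehot_cts K j =
     [([Suc j], BEq (AVar (Suc j)) (AVar j), [(True, code_exp K j [Suc j])]),
      ([Suc j], BNot (BEq (AVar (Suc j)) (AVar j)), [(False, code_exp K j [Suc j])])]"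

text \<open>A variable listed twice ends up with the later register, in accordance with the
  innermost quantifier binding it.\<close>

fun rename :: "(fovar \<Rightarrow> nat) \<Rightarrow> fovar list \<Rightarrow> nat \<Rightarrow> fovar \<Rightarrow> nat" where
  "rename \<rho> [] j = \<rho>"
| "rename \<rho> (x # xs) j = rename (\<rho>(x := j)) xs (Suc j)"

text \<open>Existential quantifiers become loops over disjuncts, universal ones loops over clauses.
  Registers from \<open>m\<close> on remain for quantifiers inside the first-order parts.\<close>

fun sigma2_template ::
  "vocabulary \<Rightarrow> nat \<Rightarrow> nat \<Rightarrow> (fovar \<Rightarrow> nat) \<Rightarrow> (sovar \<Rightarrow> nat) \<Rightarrow> sigma2 \<Rightarrow> template" where
  "sigma2_template \<sigma> K j \<rho> \<eta> (Sigma2 xs ys Cs) =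
     (let j' = j + length xs; m = j' + length ys
      in [([j..<j'], map (clause_ct \<sigma> K (rename (rename \<rho> xs j) ys j') \<eta> m [j'..<m]) Cs)])"

text \<open>Block numbers are consecutive from \<open>j\<close>, so the length of the list yields
  the next free number.\<close>

fun blocks :: "nat \<Rightarrow> qso \<Rightarrow> (nat \<times> nat) list" where
  "blocks j (Formula \<phi>) = []"
| "blocks j (Const s) = map (\<lambda>i. (j + i, 0)) [0..<s]"
| "blocks j (Plus \<alpha> \<beta>) =
     (let bs = blocks (Suc j) \<alpha> in (j, 0) # bs @ blocks (Suc j + length bs) \<beta>)"
| "blocks j (SumFO x \<alpha>) = (j, 1) # blocks (Suc j) \<alpha>"
| "blocks j (SumSO X \<alpha>) = (j, arity X) # blocks (Suc j) \<alpha>"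

definition add_cts :: "clause_template list \<Rightarrow> template \<Rightarrow> template" where
  "add_cts cts tm = map (\<lambda>(rs, cts'). (rs, cts @ cts')) tm"

definition add_reg :: "nat \<Rightarrow> template \<Rightarrow> template" where
  "add_reg r tm = map (\<lambda>(rs, cts). (r # rs, cts)) tm"

definition zero_cts :: "nat \<Rightarrow> (nat \<times> nat) list \<Rightarrow> clause_template list" where
  "zero_cts K bs = map (\<lambda>(j, k). all_ct K False j k) bs"

text \<open>The number \<open>j\<close> names both the block of a binder and, for first-order sums,
  the register with the chosen value. A constant \<open>s\<close> gives \<open>s\<close> disjuncts,
  each with a different one of \<open>s\<close> selectors true; for \<open>s = 0\<close> there is
  none.\<close>

fun template ::
  "vocabulary \<Rightarrow> nat \<Rightarrow> nat \<Rightarrow> (fovar \<Rightarrow> nat) \<Rightarrow> (sovar \<Rightarrow> nat) \<Rightarrow> qso \<Rightarrow> template" where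
  "template \<sigma> K j \<rho> \<eta> (Formula \<phi>) = sigma2_template \<sigma> K j \<rho> \<eta> \<phi>"
| "template \<sigma> K j \<rho> \<eta> (Const s) =
     map (\<lambda>i. ([], map (\<lambda>i'. all_ct K (i' = i) (j + i') 0) [0..<s])) [0..<s]"
| "template \<sigma> K j \<rho> \<eta> (Plus \<alpha> \<beta>) =
     (let as = blocks (Suc j) \<alpha>; j' = Suc j + length as; bs = blocks j' \<beta>
      in add_cts (all_ct K True j 0 # zero_cts K bs) (template \<sigma> K (Suc j) \<rho> \<eta> \<alpha>) @
         add_cts (all_ct K False j 0 # zero_cts K as) (template \<sigma> K j' \<rho> \<eta> \<beta>))"
| "template \<sigma> K j \<rho> \<eta> (SumFO x \<alpha>) =
     add_reg j (add_cts (onehot_cts K j) (template \<sigma> K (Suc j) (\<rho>(x := j)) \<eta> \<alpha>))"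
| "template \<sigma> K j \<rho> \<eta> (SumSO X \<alpha>) =
     add_cts [free_ct K j (arity X)] (template \<sigma> K (Suc j) \<rho> (\<eta>(X := j)) \<alpha>)"

text \<open>Inner loops over disjuncts leave the registers below \<open>j\<close> alone, so a value
  chosen by an outer first-order sum is still there when its one-hot clauses are
  instantiated.\<close>

lemma template_regs: "(rs, cts) \<in> set (template \<sigma> K j \<rho> \<eta> \<alpha>) \<Longrightarrow> set rs \<subseteq> {j..}"
proof (induction \<alpha> arbitrary: j \<rho> \<eta> rs cts)
  case (Formula \<phi>)
  then show ?case by (cases \<phi>) (auto simp: Let_def)
next
  case (Plus \<alpha> \<beta>)
  then show ?case by (fastforce simp: Let_def add_cts_def)
next
  case (SumFO x \<alpha>)
  then show ?case by (fastforce simp: add_cts_def add_reg_def)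
next
  case (SumSO x \<alpha>)
  then show ?case by (fastforce simp: add_cts_def)
qed auto

text \<open>Each disjunct yields at most one literal, and a first-order disjunct, of which there is
  at least one, yields none.\<close>

lemma clause_ct_length:
  "wf_clause \<sigma> C \<Longrightarrow> length (snd (snd (clause_ct \<sigma> K \<rho> \<eta> m rs C))) \<le> 2"
proof (cases C)
  case (Clause d1 d2 d3)
  moreover have "length (disjunct_lits K \<rho> \<eta> d) \<le> 1" "is_FO d \<Longrightarrow> disjunct_lits K \<rho> \<eta> d = []" for d
    by (cases d; simp)+
  note this[of d1] this[of d2] this[of d3]
  moreover assume "wf_clause \<sigma> C"
  ultimately show ?thesis by auto
qed

lemma template_length:
  "wf_qso \<sigma> \<alpha> \<Longrightarrow> (rs, cts) \<in> set (template \<sigma> K j \<rho> \<eta> \<alpha>) \<Longrightarrow> ct \<in> set cts \<Longrightarrow>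
   length (snd (snd ct)) \<le> 2"
proof (induction \<alpha> arbitrary: j \<rho> \<eta> rs cts)
  case (Formula \<phi>)
  then show ?case by (cases \<phi>) (auto simp: Let_def intro!: clause_ct_length)
next
  case (Const s)
  then show ?case by (auto simp: all_ct_def)
next
  case (Plus \<alpha> \<beta>)
  then show ?case by (fastforce simp: Let_def add_cts_def all_ct_def zero_cts_def)
next
  case (SumFO x \<alpha>)
  then show ?case by (fastforce simp: add_cts_def add_reg_def onehot_cts_def)
next
  case (SumSO x \<alpha>)
  then show ?case by (fastforce simp: add_cts_def free_ct_def)
qed

section \<open>Satisfaction and variables of composed templates\<close>

lemma sat_template_append:
  "sat_template D n T w (xs @ ys) \<longleftrightarrow> sat_template D n T w xs \<or> sat_template D n T w ys"
  by (simp add: sat_template_def bex_Un)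

lemma sat_add_reg:
  "sat_template D n T w (add_reg r tm) \<longleftrightarrow> (\<exists>i<n. sat_template D n T (w(r := i)) tm)"
  by (simp add: sat_template_def add_reg_def split_beta atLeast0LessThan bex_UN) blast

text \<open>The added clauses sit inside the loops of \<open>tm\<close>. They can be pulled out as
  \<open>P\<close> because their truth value is the same in all iterations.\<close>

lemma sat_add_cts:
  assumes "\<And>rs cts' w'. (rs, cts') \<in> set tm \<Longrightarrow> w' \<in> set (envs n rs w) \<Longrightarrow>
    (\<forall>ct \<in> set cts. sat_ct D n T w' ct) = P"
  shows "sat_template D n T w (add_cts cts tm) \<longleftrightarrow> P \<and> sat_template D n T w tm"
proof -
  have "(\<forall>ct \<in> set cts \<union> set (snd dt). sat_ct D n T w' ct) \<longleftrightarrow>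
      P \<and> (\<forall>ct \<in> set (snd dt). sat_ct D n T w' ct)"
    if "dt \<in> set tm" "w' \<in> set (envs n (fst dt) w)" for dt w'
    using assms[of "fst dt" "snd dt" w'] that by (simp add: ball_Un)
  then have "(\<exists>dt \<in> set tm. \<exists>w' \<in> set (envs n (fst dt) w).
        \<forall>ct \<in> set cts \<union> set (snd dt). sat_ct D n T w' ct) \<longleftrightarrow>
      (\<exists>dt \<in> set tm. \<exists>w' \<in> set (envs n (fst dt) w). P \<and> (\<forall>ct \<in> set (snd dt). sat_ct D n T w' ct))"
    by (intro bex_cong refl)
  then show ?thesis
    by (simp add: sat_template_def add_cts_def split_beta)
qed

lemma block_envs: "code n K j ` (\<lambda>w'. map w' [0..<k]) ` set (envs n [0..<k] w) = block n K j k"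
  by (simp add: envs_tuples block_def)

lemma sat_all_ct:
  "sat_ct D n T w (all_ct K b j k) \<longleftrightarrow> (if b then block n K j k \<subseteq> T else T \<inter> block n K j k = {})"
  unfolding all_ct_def block_envs[symmetric, of n K j k w] by (auto simp: aval_code_exp)

lemma vars_all_ct: "ct_vars D n w (all_ct K b j k) = block n K j k"
  unfolding all_ct_def block_envs[symmetric, of n K j k w] by (auto simp: aval_code_exp)

lemma sat_free_ct: "sat_ct D n T w (free_ct K j k)"
  unfolding free_ct_def by auto

lemma vars_free_ct: "ct_vars D n w (free_ct K j k) = block n K j k"
  unfolding free_ct_def block_envs[symmetric, of n K j k w] by (auto simp: aval_code_exp)

lemma block_1: "block n K j (Suc 0) = (\<lambda>i. code n K j [i]) ` {..<n}"
  by (simp add: block_def tuples_1 image_image)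

lemma block_0: "block n K j 0 = {code n K j []}"
  by (simp add: block_def tuples_0)

lemma code_1_inj:
  "n \<noteq> 0 \<Longrightarrow> 1 \<le> K \<Longrightarrow> i < n \<Longrightarrow> i' < n \<Longrightarrow> code n K j [i] = code n K j [i'] \<Longrightarrow> i = i'"
  using code_inj[of "[i]" n 1 "[i']" 1 K j j] by (auto simp: tuples_def)

lemma sat_onehot_cts:
  assumes "n \<noteq> 0" "1 \<le> K" "w j < n"
  shows "(\<forall>ct \<in> set (onehot_cts K j). sat_ct D n T w ct) \<longleftrightarrow>
    T \<inter> block n K j 1 = {code n K j [w j]}"
proof -
  have "(\<forall>ct \<in> set (onehot_cts K j). sat_ct D n T w ct) \<longleftrightarrow>
      (\<forall>i<n. code n K j [i] \<in> T \<longleftrightarrow> i = w j)"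
    using assms(3) by (auto simp: onehot_cts_def aval_code_exp)
  also have "\<dots> \<longleftrightarrow> T \<inter> block n K j 1 = {code n K j [w j]}"
    unfolding One_nat_def block_1 using code_1_inj[OF assms(1,2) _ assms(3)] assms(3)
    by (intro iffI) blast+
  finally show ?thesis .
qed

lemma vars_onehot_cts:
  "w j < n \<Longrightarrow> (\<Union>ct \<in> set (onehot_cts K j). ct_vars D n w ct) = block n K j 1"
  unfolding One_nat_def block_1
  by (auto simp: onehot_cts_def aval_code_exp) (metis atLeastLessThan_iff le0)

section \<open>Semantics of the templates\<close>

locale encoded_structure =
  fixes \<sigma> :: vocabulary and A :: "'a ordered_structure"
  assumes A: "A \<in> ordered_structures \<sigma>"
begin

definition "us = enumeration A"
definition "n = length us"
definition "D = enc_structure \<sigma> A"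

lemma set_us: "set us = univ A" and distinct_us: "distinct us"
  using theI'[OF enumeration_ex1[of A]] A
  by (auto simp: us_def enumeration_def ordered_structures_def)

lemma n_pos: "n \<noteq> 0"
  using set_us A by (auto simp: n_def ordered_structures_def)

lemma card_univ: "card (univ A) = n"
  using distinct_card[OF distinct_us] by (simp add: set_us n_def)

lemma univ_image: "univ A = (!) us ` {..<n}"
  unfolding set_us[symmetric] n_def by (auto simp: set_conv_nth)

lemma inj_nth: "inj_on ((!) us) {..<n}"
  using distinct_us by (auto simp: inj_on_def n_def nth_eq_iff_index_eq)

lemma uval_D: "uval D = n"
  by (simp add: D_def enc_structure_def card_univ)

lemma lookup:
  assumes "i < length \<sigma>" "ts \<in> tuples {..<n} (\<sigma> ! i)"
  shows "top_bit (drop (n + 1 + (sum_list (map ((^) n) (take i \<sigma>)) + horner n ts)) D) \<longleftrightarrow>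
    map ((!) us) ts \<in> rel A i"
proof -
  let ?f = "\<lambda>i. map (\<lambda>xs. xs \<in> rel A i) (product_lists (replicate (\<sigma> ! i) us))"
  let ?xss = "map ?f [0..<length \<sigma>]"
  have ts: "length ts = \<sigma> ! i" "set ts \<subseteq> {..<n}" using assms(2) by (auto simp: tuples_def)
  have h: "horner n ts < n ^ (\<sigma> ! i)" using horner_less[OF ts(2)] ts(1) by simp
  have len: "length (?f j) = n ^ (\<sigma> ! j)" for j
    by (simp add: length_product_lists_replicate n_def)
  have "map length (take i ?xss) = map ((^) n) (take i \<sigma>)"
    using assms(1) by (intro nth_equalityI) (auto simp: length_product_lists_replicate n_def)
  then have "drop (sum_list (map ((^) n) (take i \<sigma>)) + horner n ts) (concat ?xss) =
      drop (horner n ts) (?f i) @ concat (drop (Suc i) ?xss)"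
    using drop_concat[of i ?xss "horner n ts"] assms(1) h len[of i] by simp
  moreover have "drop (n + 1 + m) D = drop m (concat ?xss)" for m
    by (simp add: D_def enc_structure_def card_univ us_def)
  ultimately have "top_bit (drop (n + 1 + (sum_list (map ((^) n) (take i \<sigma>)) + horner n ts)) D) =
      ?f i ! horner n ts"
    using top_bit_drop[of "horner n ts" "?f i"] h len[of i] by simp
  also have "\<dots> \<longleftrightarrow> product_lists (replicate (\<sigma> ! i) us) ! horner n ts \<in> rel A i"
    using h len[of i] by simp
  also have "product_lists (replicate (\<sigma> ! i) us) ! horner n ts = map ((!) us) ts"
    using nth_product_lists[of ts us] ts by (simp add: n_def)
  finally show ?thesis .
qed

text \<open>Registers hold positions in the enumeration, while \<open>v\<close> holds the elements
  at these positions. The bound \<open>m\<close> ensures that a new binder can take register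
  \<open>m\<close> without disturbing the variables in \<open>S\<close>.\<close>

definition agree ::
  "(fovar \<Rightarrow> nat) \<Rightarrow> nat \<Rightarrow> (nat \<Rightarrow> nat) \<Rightarrow> 'a fo_assignment \<Rightarrow> fovar set \<Rightarrow> bool" where
  "agree \<rho> m w v S \<longleftrightarrow> (\<forall>x \<in> S. \<rho> x < m \<and> w (\<rho> x) < n \<and> v x = us ! w (\<rho> x))"

lemma agree_subset: "agree \<rho> m w v S \<Longrightarrow> S' \<subseteq> S \<Longrightarrow> agree \<rho> m w v S'"
  by (auto simp: agree_def)

lemma agree_mono: "agree \<rho> m w v S \<Longrightarrow> m \<le> m' \<Longrightarrow> agree \<rho> m' w v S"
  by (force simp: agree_def)

lemma agree_upd:
  "agree \<rho> m w v (S - {x}) \<Longrightarrow> i < n \<Longrightarrow> agree (\<rho>(x := m)) (Suc m) (w(m := i)) (v(x := us ! i)) S"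
  unfolding agree_def by (auto simp: less_Suc_eq)

lemma agree_tuples:
  assumes "agree \<rho> m w v S" "set xs \<subseteq> S"
  shows "map w (map \<rho> xs) \<in> tuples {..<n} (length xs)" "map v xs = map ((!) us) (map w (map \<rho> xs))"
  using assms by (auto simp: agree_def tuples_def)

lemma bval_fo_bexp:
  "wf_fo \<sigma> \<phi> \<Longrightarrow> agree \<rho> m w v (fv_fo \<phi>) \<Longrightarrow> bval D n w (fo_bexp \<sigma> \<rho> m \<phi>) \<longleftrightarrow> sat_fo A v \<phi>"
proof (induction \<phi> arbitrary: \<rho> m w v)
  case (FEq x y)
  then show ?case using inj_nth by (auto simp: agree_def inj_on_eq_iff)
next
  case (FRel i xs)
  then have i: "i < length \<sigma>" "length xs = \<sigma> ! i" by auto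
  have t: "map w (map \<rho> xs) \<in> tuples {..<n} (\<sigma> ! i)"
    and m: "map v xs = map ((!) us) (map w (map \<rho> xs))"
    using agree_tuples[OF FRel.prems(2), of xs] i(2) by simp_all
  show ?case
    unfolding sat_fo.simps m lookup[OF i(1) t, symmetric]
    by (simp add: rel_exp_def aval_offset_exp aval_horner_exp del: map_map)
next
  case (FOr \<phi> \<psi>)
  then show ?case
    using agree_subset[OF FOr.prems(2), of "fv_fo \<phi>"] agree_subset[OF FOr.prems(2), of "fv_fo \<psi>"]
    by auto
next
  case (FEx x \<phi>)
  have "bval D n (w(m := i)) (fo_bexp \<sigma> (\<rho>(x := m)) (Suc m) \<phi>) \<longleftrightarrow> sat_fo A (v(x := us ! i)) \<phi>"
    if "i < n" for i
    using FEx.IH agree_upd[of \<rho> m w v "fv_fo \<phi>" x i] FEx.prems that by auto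
  then show ?case by (auto simp: univ_image)
qed auto

definition decode :: "nat \<Rightarrow> nat \<Rightarrow> nat \<Rightarrow> nat set \<Rightarrow> 'a list set" where
  "decode K j k T = map ((!) us) ` {ts \<in> tuples {..<n} k. code n K j ts \<in> T}"

lemma inj_map_nth: "inj_on (map ((!) us)) (tuples {..<n} k)"
  by (rule inj_on_mapI[OF inj_on_subset[OF inj_nth]]) (auto simp: tuples_def)

lemma map_in_decode:
  "ts \<in> tuples {..<n} k \<Longrightarrow> map ((!) us) ts \<in> decode K j k T \<longleftrightarrow> code n K j ts \<in> T"
  unfolding decode_def using inj_map_nth[of k] by (auto simp: inj_on_def)

definition agree_so ::
  "nat \<Rightarrow> (sovar \<Rightarrow> nat) \<Rightarrow> nat set \<Rightarrow> 'a so_assignment \<Rightarrow> sovar set \<Rightarrow> bool" where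
  "agree_so K \<eta> T V S \<longleftrightarrow> (\<forall>X \<in> S. V X = decode K (\<eta> X) (arity X) T)"

lemma disjunct_sat:
  assumes "wf_disjunct \<sigma> d" "agree \<rho> m w v (fv_disjunct d)" "agree_so K \<eta> T V (sov_disjunct d)"
  shows "sat_disjunct A v V d \<longleftrightarrow> bval D n w (disjunct_guard \<sigma> \<rho> m d) \<or>
    (\<exists>(s, e) \<in> set (disjunct_lits K \<rho> \<eta> d). (aval n w e \<in> T) = s)"
proof (cases d)
  case (Pos X xs)
  with assms agree_tuples[of \<rho> m w v "set xs" xs] show ?thesis
    by (simp add: agree_so_def aval_code_exp map_in_decode del: map_map)
next
  case (Neg X xs)
  with assms agree_tuples[of \<rho> m w v "set xs" xs] show ?thesis
    by (simp add: agree_so_def aval_code_exp map_in_decode del: map_map)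
next
  case (FO \<phi>)
  with assms show ?thesis by (simp add: bval_fo_bexp)
qed

lemma disjunct_vars:
  assumes "wf_disjunct \<sigma> d" "agree \<rho> m w v (fv_disjunct d)"
  shows "(\<lambda>(s, e). aval n w e) ` set (disjunct_lits K \<rho> \<eta> d) \<subseteq>
    (\<Union>X \<in> sov_disjunct d. block n K (\<eta> X) (arity X))"
proof (cases d)
  case (Pos X xs)
  with assms agree_tuples[of \<rho> m w v "set xs" xs] show ?thesis
    by (simp add: aval_code_exp code_in_block del: map_map)
next
  case (Neg X xs)
  with assms agree_tuples[of \<rho> m w v "set xs" xs] show ?thesis
    by (simp add: aval_code_exp code_in_block del: map_map)
qed simp

lemma clause_sat:
  assumes "wf_clause \<sigma> C" "agree \<rho> m w v (fv_clause C)" "agree_so K \<eta> T V (sov_clause C)"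
    and "clause_ct \<sigma> K \<rho> \<eta> m rs C = (rs', b, ls)"
  shows "(bval D n w b \<longrightarrow> (\<exists>(s, e) \<in> set ls. (aval n w e \<in> T) = s)) \<longleftrightarrow> sat_clause A v V C"
proof (cases C)
  case (Clause d1 d2 d3)
  have *: "sat_disjunct A v V d \<longleftrightarrow> bval D n w (disjunct_guard \<sigma> \<rho> m d) \<or>
    (\<exists>(s, e) \<in> set (disjunct_lits K \<rho> \<eta> d). (aval n w e \<in> T) = s)" if "d \<in> {d1, d2, d3}" for d
    using assms that Clause by (intro disjunct_sat) (auto simp: agree_so_def agree_def)
  have b: "b = BNot (BOr (disjunct_guard \<sigma> \<rho> m d1)
        (BOr (disjunct_guard \<sigma> \<rho> m d2) (disjunct_guard \<sigma> \<rho> m d3)))"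
    and ls: "ls = disjunct_lits K \<rho> \<eta> d1 @ disjunct_lits K \<rho> \<eta> d2 @ disjunct_lits K \<rho> \<eta> d3"
    using assms(4) by (auto simp: Clause)
  note s1 = *[of d1, OF insertI1] and s2 = *[of d2, OF insertI2[OF insertI1]]
    and s3 = *[of d3, OF insertI2[OF insertI2[OF insertI1]]]
  show ?thesis
    unfolding b ls Clause sat_clause.simps s1 s2 s3 bval.simps set_append bex_Un by argo
qed

lemma clause_vars:
  assumes "wf_clause \<sigma> C" "agree \<rho> m w v (fv_clause C)"
    and "clause_ct \<sigma> K \<rho> \<eta> m rs C = (rs', b, ls)"
  shows "(\<lambda>(s, e). aval n w e) ` set ls \<subseteq> (\<Union>X \<in> sov_clause C. block n K (\<eta> X) (arity X))"
proof (cases C)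
  case (Clause d1 d2 d3)
  have *: "(\<lambda>(s, e). aval n w e) ` set (disjunct_lits K \<rho> \<eta> d) \<subseteq>
    (\<Union>X \<in> sov_disjunct d. block n K (\<eta> X) (arity X))" if "d \<in> {d1, d2, d3}" for d
    using assms that Clause by (intro disjunct_vars) (auto simp: agree_def)
  have ls: "ls = disjunct_lits K \<rho> \<eta> d1 @ disjunct_lits K \<rho> \<eta> d2 @ disjunct_lits K \<rho> \<eta> d3"
    using assms(3) by (auto simp: Clause)
  show ?thesis
    unfolding ls Clause set_append image_Un sov_clause.simps Union_Un_distrib Un_assoc
    by (intro Un_mono *) auto
qed

text \<open>Quantifiers over elements turn into loops over positions. \<open>P\<close> and
  \<open>Q\<close> need to correspond only where registers and assignment agree, which allows blocks
  to be nested.\<close>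

lemma ex_block_envs:
  assumes "\<And>v' w'. agree (rename \<rho> xs j) (j + length xs) w' v' S \<Longrightarrow> P v' = Q w'"
    and "agree \<rho> j w v (S - set xs)"
  shows "ex_block (univ A) xs P v \<longleftrightarrow> (\<exists>w' \<in> set (envs n [j..<j + length xs] w). Q w')"
  using assms
proof (induction xs arbitrary: \<rho> j w v)
  case Nil
  then show ?case by simp
next
  case (Cons x xs)
  have "ex_block (univ A) xs P (v(x := us ! i)) \<longleftrightarrow>
      (\<exists>w' \<in> set (envs n [Suc j..<Suc j + length xs] (w(j := i))). Q w')" if "i < n" for i
  proof (rule Cons.IH)
    show "agree (\<rho>(x := j)) (Suc j) (w(j := i)) (v(x := us ! i)) (S - set xs)"
      by (rule agree_upd[OF agree_subset[OF Cons.prems(2)] that]) auto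
  qed (use Cons.prems(1) in \<open>simp del: fun_upd_apply\<close>)
  moreover have "[j..<j + length (x # xs)] = j # [Suc j..<Suc j + length xs]"
    by (subst upt_conv_Cons) simp_all
  ultimately show ?case
    by (auto simp: univ_image atLeast0LessThan)
qed

lemma all_block_ex_block: "all_block U xs P v \<longleftrightarrow> \<not> ex_block U xs (\<lambda>w. \<not> P w) v"
  by (induction xs arbitrary: v) auto

lemma all_block_envs:
  assumes "\<And>v' w'. agree (rename \<rho> xs j) (j + length xs) w' v' S \<Longrightarrow> P v' = Q w'"
    and "agree \<rho> j w v (S - set xs)"
  shows "all_block (univ A) xs P v \<longleftrightarrow> (\<forall>w' \<in> set (envs n [j..<j + length xs] w). Q w')"
  unfolding all_block_ex_block using ex_block_envs[of \<rho> xs j S "\<lambda>w. \<not> P w" "\<lambda>w. \<not> Q w" w v] assms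
  by auto

lemma envs_agree:
  assumes "agree \<rho> j w v (S - set xs)" "w' \<in> set (envs n [j..<j + length xs] w)"
  shows "\<exists>v'. agree (rename \<rho> xs j) (j + length xs) w' v' S"
proof (rule ccontr)
  assume no: "\<not> ?thesis"
  \<comment> \<open>If no assignment agreed with \<open>w'\<close>, the false predicate would
    correspond to the predicate of being \<open>w'\<close>. As \<open>w'\<close> is among the
    enumerated environments, \<open>ex_block_envs\<close> would then make an existential block over
    false true.\<close>
  have "ex_block (univ A) xs (\<lambda>_. False) v \<longleftrightarrow>
      (\<exists>u \<in> set (envs n [j..<j + length xs] w). \<exists>v'. u = w' \<and> \<not> agree (rename \<rho> xs j) (j + length xs) u v' S)"
    by (rule ex_block_envs[OF _ assms(1)]) (use no in auto)
  moreover have "\<not> ex_block (univ A) xs (\<lambda>_. False) v" for v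
    by (induction xs arbitrary: v) auto
  ultimately show False using assms(2) no by blast
qed

lemma ball_swap: "(\<forall>x \<in> X. \<forall>y \<in> Y. P x y) \<longleftrightarrow> (\<forall>y \<in> Y. \<forall>x \<in> X. P x y)"
  by blast

lemma sigma2_sat:
  assumes "wf_sigma2 \<sigma> \<phi>" "agree \<rho> j w v (fv_sigma2 \<phi>)" "agree_so K \<eta> T V (sov_sigma2 \<phi>)"
  shows "sat_template D n T w (sigma2_template \<sigma> K j \<rho> \<eta> \<phi>) \<longleftrightarrow> sat_sigma2 A v V \<phi>"
proof (cases \<phi>)
  case (Sigma2 xs ys Cs)
  define j' where "j' = j + length xs"
  define m where "m = j' + length ys"
  define ct where "ct = clause_ct \<sigma> K (rename (rename \<rho> xs j) ys j') \<eta> m [j'..<m]"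
  let ?S = "\<Union>C \<in> set Cs. fv_clause C"
  let ?R = "\<lambda>w C. case ct C of (rs, b, ls) \<Rightarrow>
    bval D n w b \<longrightarrow> (\<exists>(s, e) \<in> set ls. (aval n w e \<in> T) = s)"
  have clause: "(\<forall>C \<in> set Cs. sat_clause A v V C) \<longleftrightarrow> (\<forall>C \<in> set Cs. ?R w C)"
    if a: "agree (rename (rename \<rho> xs j) ys j') m w v ?S" for v w
  proof (intro ball_cong refl)
    fix C assume C: "C \<in> set Cs"
    obtain rs b ls where ctC: "ct C = (rs, b, ls)" by (cases "ct C")
    have "agree_so K \<eta> T V (sov_clause C)" "wf_clause \<sigma> C"
      using assms(1,3) C by (auto simp: Sigma2 agree_so_def)
    with clause_sat[OF _ agree_subset[OF a], of C K \<eta> T V "[j'..<m]" rs b ls] ctC C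
    show "sat_clause A v V C \<longleftrightarrow> ?R w C" by (auto simp: ct_def)
  qed
  have all: "all_block (univ A) ys (\<lambda>w. \<forall>C \<in> set Cs. sat_clause A w V C) v \<longleftrightarrow>
      (\<forall>w' \<in> set (envs n [j'..<j' + length ys] w). \<forall>C \<in> set Cs. ?R w' C)"
    if "agree (rename \<rho> xs j) (j + length xs) w v (?S - set ys)" for v w
    by (rule all_block_envs[OF clause]) (use that in \<open>simp_all add: j'_def m_def\<close>)
  have "sat_sigma2 A v V \<phi> \<longleftrightarrow> (\<exists>w1 \<in> set (envs n [j..<j + length xs] w).
      \<forall>w' \<in> set (envs n [j'..<j' + length ys] w1). \<forall>C \<in> set Cs. ?R w' C)"
    unfolding Sigma2 sat_sigma2.simps
    by (rule ex_block_envs[OF all])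
      (use assms(2) in \<open>auto simp: Sigma2 Diff_eq Int_commute Int_left_commute\<close>)
  moreover have "sat_ct D n T w1 (ct C) \<longleftrightarrow>
      (\<forall>w' \<in> set (envs n [j'..<j' + length ys] w1). ?R w' C)" for w1 C
    by (cases C) (simp add: ct_def m_def)
  moreover have "sat_template D n T w (sigma2_template \<sigma> K j \<rho> \<eta> \<phi>) \<longleftrightarrow>
      (\<exists>w1 \<in> set (envs n [j..<j + length xs] w). \<forall>C \<in> set Cs. sat_ct D n T w1 (ct C))"
    by (simp add: Sigma2 sat_template_def Let_def ct_def m_def j'_def)
  moreover have "(\<forall>C \<in> set Cs. \<forall>w' \<in> W. ?R w' C) \<longleftrightarrow> (\<forall>w' \<in> W. \<forall>C \<in> set Cs. ?R w' C)" for W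
    by (rule ball_swap)
  ultimately show ?thesis by (simp only:)
qed

text \<open>A code lies in its block only if the registers hold values below \<open>n\<close>;
  \<open>envs_agree\<close> supplies this for all instances.\<close>

lemma sigma2_vars:
  assumes "wf_sigma2 \<sigma> \<phi>" "agree \<rho> j w v (fv_sigma2 \<phi>)"
    and "(rs, cts) \<in> set (sigma2_template \<sigma> K j \<rho> \<eta> \<phi>)" "w1 \<in> set (envs n rs w)" "ct \<in> set cts"
  shows "ct_vars D n w1 ct \<subseteq> (\<Union>X \<in> sov_sigma2 \<phi>. block n K (\<eta> X) (arity X))"
proof (cases \<phi>)
  case (Sigma2 xs ys Cs)
  define j' where "j' = j + length xs"
  define m where "m = j' + length ys"
  let ?S = "\<Union>C \<in> set Cs. fv_clause C"
  obtain C where C: "C \<in> set Cs"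
      "ct = clause_ct \<sigma> K (rename (rename \<rho> xs j) ys j') \<eta> m [j'..<m] C"
    using assms(3,5) by (auto simp: Sigma2 Let_def j'_def m_def)
  obtain b ls where ct: "ct = ([j'..<m], b, ls)" using C(2) by (cases C) auto
  have w1: "w1 \<in> set (envs n [j..<j + length xs] w)"
    using assms(3,4) by (auto simp: Sigma2 Let_def)
  have "agree \<rho> j w v (?S - set ys - set xs)"
    using assms(2) by (rule agree_subset) (auto simp: Sigma2)
  from envs_agree[OF this w1] obtain v1 where
    a1: "agree (rename \<rho> xs j) j' w1 v1 (?S - set ys)" by (auto simp: j'_def)
  have "(\<lambda>(s, e). aval n w2 e) ` set ls \<subseteq> (\<Union>X \<in> sov_clause C. block n K (\<eta> X) (arity X))"
    if "w2 \<in> set (envs n [j'..<m] w1)" for w2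
  proof -
    from envs_agree[OF a1] that obtain v2 where
      "agree (rename (rename \<rho> xs j) ys j') m w2 v2 ?S" by (auto simp: m_def)
    then have "agree (rename (rename \<rho> xs j) ys j') m w2 v2 (fv_clause C)"
      by (rule agree_subset) (use C(1) in auto)
    moreover have "wf_clause \<sigma> C" using assms(1) C(1) by (simp add: Sigma2)
    ultimately show ?thesis using clause_vars[OF _ _ C(2)[symmetric, unfolded ct]] by blast
  qed
  moreover have "(\<Union>X \<in> sov_clause C. block n K (\<eta> X) (arity X)) \<subseteq>
      (\<Union>X \<in> sov_sigma2 \<phi>. block n K (\<eta> X) (arity X))"
    using C(1) by (auto simp: Sigma2)
  ultimately show ?thesis unfolding ct by fastforce
qed

end

section \<open>Counting\<close>

declare ct_vars.simps [simp del] sat_ct.simps [simp del]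

text \<open>Only binders and selectors open blocks. The literals of a sentence use the blocks of
  their binders, so formulae contribute nothing; a first-order binder needs arity 1.\<close>

fun max_arity :: "qso \<Rightarrow> nat" where
  "max_arity (Formula \<phi>) = 0"
| "max_arity (Const s) = 0"
| "max_arity (Plus \<alpha> \<beta>) = max (max_arity \<alpha>) (max_arity \<beta>)"
| "max_arity (SumFO x \<alpha>) = max 1 (max_arity \<alpha>)"
| "max_arity (SumSO X \<alpha>) = max (arity X) (max_arity \<alpha>)"

lemma blocks_bounds:
  "(i, k) \<in> set (blocks j \<alpha>) \<Longrightarrow> j \<le> i \<and> i < j + length (blocks j \<alpha>) \<and> k \<le> max_arity \<alpha>"
  by (induction \<alpha> arbitrary: j) (fastforce simp: Let_def)+

lemma card_subsets_Un:
  assumes "finite P" "finite Q" "P \<inter> Q = {}"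
  shows "card {T. T \<subseteq> P \<union> Q \<and> R T} = (\<Sum>T1 \<in> Pow P. card {T2. T2 \<subseteq> Q \<and> R (T1 \<union> T2)})"
proof -
  let ?S = "SIGMA T1 : Pow P. {T2. T2 \<subseteq> Q \<and> R (T1 \<union> T2)}"
  have "bij_betw (\<lambda>(T1, T2). T1 \<union> T2) ?S {T. T \<subseteq> P \<union> Q \<and> R T}"
  proof (rule bij_betw_byWitness[where f' = "\<lambda>T. (T \<inter> P, T \<inter> Q)"])
    have "(T1 \<union> T2) \<inter> P = T1 \<and> (T1 \<union> T2) \<inter> Q = T2" if "T1 \<subseteq> P" "T2 \<subseteq> Q" for T1 T2
      using that assms(3) by blast
    then show "\<forall>x \<in> ?S. (\<lambda>T. (T \<inter> P, T \<inter> Q)) (case x of (T1, T2) \<Rightarrow> T1 \<union> T2) = x"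
      by auto
    have T: "T \<inter> P \<union> T \<inter> Q = T" if "T \<subseteq> P \<union> Q" for T using that by blast
    then show "\<forall>T \<in> {T. T \<subseteq> P \<union> Q \<and> R T}. (case (T \<inter> P, T \<inter> Q) of (T1, T2) \<Rightarrow> T1 \<union> T2) = T"
      by simp
    show "(\<lambda>T. (T \<inter> P, T \<inter> Q)) ` {T. T \<subseteq> P \<union> Q \<and> R T} \<subseteq> ?S"
      using T by auto
    show "(\<lambda>(T1, T2). T1 \<union> T2) ` ?S \<subseteq> {T. T \<subseteq> P \<union> Q \<and> R T}"
      by auto
  qed
  from bij_betw_same_card[OF this] show ?thesis
    using assms(1,2) by (simp add: card_SigmaI)
qed

lemma Int_image_eq_singleton:
  assumes "inj_on f I" "i \<in> I"
  shows "T \<inter> f ` I = {f i} \<longleftrightarrow> (\<forall>i' \<in> I. f i' \<in> T \<longleftrightarrow> i' = i)"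
proof -
  have "f i' = f i \<Longrightarrow> i' = i" if "i' \<in> I" for i'
    using assms that by (auto simp: inj_on_def)
  then show ?thesis using assms(2) by (intro iffI) (blast, auto)
qed

context encoded_structure
begin

section \<open>Variables of a sentence and the meaning of an assignment\<close>

definition block_vars :: "nat \<Rightarrow> (nat \<times> nat) list \<Rightarrow> nat set" where
  "block_vars K bs = (\<Union>(j, k) \<in> set bs. block n K j k)"

lemma block_vars_simps [simp]:
  "block_vars K [] = {}"
  "block_vars K ((j, k) # bs) = block n K j k \<union> block_vars K bs"
  "block_vars K (bs @ cs) = block_vars K bs \<union> block_vars K cs"
  by (auto simp: block_vars_def)

lemma finite_block_vars: "finite (block_vars K bs)"
  by (auto simp: block_vars_def finite_block)

lemma block_vars_disjoint:
  assumes "\<And>i k j l. (i, k) \<in> set bs \<Longrightarrow> (j, l) \<in> set cs \<Longrightarrow> i \<noteq> j \<and> k \<le> K \<and> l \<le> K"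
  shows "block_vars K bs \<inter> block_vars K cs = {}"
proof -
  have "block n K i k \<inter> block n K j l = {}" if "(i, k) \<in> set bs" "(j, l) \<in> set cs" for i j k l
    using block_disjoint n_pos assms[OF that] by blast
  then show ?thesis unfolding block_vars_def by fastforce
qed

lemma block_vars_blocks_disjoint:
  assumes "k \<le> K" "max_arity \<alpha> \<le> K" "i < j"
  shows "block n K i k \<inter> block_vars K (blocks j \<alpha>) = {}"
  using block_vars_disjoint[of "[(i, k)]" "blocks j \<alpha>" K] blocks_bounds[of _ _ j \<alpha>] assms
  by fastforce

lemma block_vars_blocks2_disjoint:
  assumes "max_arity \<alpha> \<le> K" "max_arity \<beta> \<le> K"
  shows "block_vars K (blocks j \<alpha>) \<inter> block_vars K (blocks (j + length (blocks j \<alpha>)) \<beta>) = {}"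
  by (rule block_vars_disjoint)
    (use assms in \<open>fastforce dest!: blocks_bounds\<close>)

text \<open>\<open>T\<close> encodes a choice of summands and of values for the bound variables under which the chosen
  formula holds.\<close>

fun msat ::
  "nat \<Rightarrow> 'a fo_assignment \<Rightarrow> 'a so_assignment \<Rightarrow> nat \<Rightarrow> qso \<Rightarrow> nat set \<Rightarrow> bool" where
  "msat K v V j (Formula \<phi>) T \<longleftrightarrow> sat_sigma2 A v V \<phi>"
| "msat K v V j (Const s) T \<longleftrightarrow>
     (\<exists>i<s. T \<inter> block_vars K (blocks j (Const s)) = {code n K (j + i) []})"
| "msat K v V j (Plus \<alpha> \<beta>) T \<longleftrightarrow>
     (let as = blocks (Suc j) \<alpha>; j' = Suc j + length as; bs = blocks j' \<beta> in
      if code n K j [] \<in> T then T \<inter> block_vars K bs = {} \<and> msat K v V (Suc j) \<alpha> T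
      else T \<inter> block_vars K as = {} \<and> msat K v V j' \<beta> T)"
| "msat K v V j (SumFO x \<alpha>) T \<longleftrightarrow>
     (\<exists>i<n. T \<inter> block n K j 1 = {code n K j [i]} \<and> msat K (v(x := us ! i)) V (Suc j) \<alpha> T)"
| "msat K v V j (SumSO X \<alpha>) T \<longleftrightarrow>
     msat K v (V(X := decode K j (arity X) T)) (Suc j) \<alpha> T"

lemma sat_zero_cts:
  "(\<forall>ct \<in> set (zero_cts K bs). sat_ct D n T w ct) \<longleftrightarrow> T \<inter> block_vars K bs = {}"
  unfolding zero_cts_def block_vars_def by (simp add: split_beta sat_all_ct) blast

lemma vars_zero_cts: "(\<Union>ct \<in> set (zero_cts K bs). ct_vars D n w ct) = block_vars K bs"
  unfolding zero_cts_def block_vars_def by (simp add: vars_all_ct split_beta)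

lemma code_nil_inj: "code n K i [] = code n K j [] \<longleftrightarrow> i = j"
  by (simp add: code_def n_pos)

lemma block_vars_Const: "block_vars K (blocks j (Const s)) = (\<lambda>i. code n K (j + i) []) ` {..<s}"
  by (auto simp: block_vars_def block_0)

text \<open>\<open>msat\<close> mentions neither registers nor clauses, so from here on counting is
  independent of the syntax of templates.\<close>

lemma template_sat:
  assumes "wf_qso \<sigma> \<alpha>" "max_arity \<alpha> \<le> K" "agree \<rho> j w v (fv_qso \<alpha>)"
    and "agree_so K \<eta> T V (sov_qso \<alpha>)"
  shows "sat_template D n T w (template \<sigma> K j \<rho> \<eta> \<alpha>) \<longleftrightarrow> msat K v V j \<alpha> T"
  using assms
proof (induction \<alpha> arbitrary: j \<rho> \<eta> w v V)
  case (Formula \<phi>)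
  then show ?case by (simp add: sigma2_sat)
next
  case (Const s)
  have "sat_ct D n T w (all_ct K b i 0) \<longleftrightarrow> (code n K i [] \<in> T) = b" for i b
    by (cases b) (auto simp: sat_all_ct block_0)
  then have "sat_template D n T w (template \<sigma> K j \<rho> \<eta> (Const s)) \<longleftrightarrow>
      (\<exists>i<s. \<forall>i'<s. code n K (j + i') [] \<in> T \<longleftrightarrow> i' = i)"
    by (simp add: sat_template_def) (simp add: Bex_def Ball_def)
  also have "\<dots> \<longleftrightarrow> msat K v V j (Const s) T"
    unfolding msat.simps block_vars_Const
    by (intro ex_cong1 conj_cong refl, subst Int_image_eq_singleton)
      (auto simp: inj_on_def code_nil_inj)
  finally show ?case .
next
  case (Plus \<alpha> \<beta>)
  let ?as = "blocks (Suc j) \<alpha>"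
  let ?j' = "Suc j + length ?as"
  let ?bs = "blocks ?j' \<beta>"
  have agree: "agree \<rho> (Suc j) w v (fv_qso \<alpha>)" "agree \<rho> ?j' w v (fv_qso \<beta>)"
    by (rule agree_mono[OF agree_subset[OF Plus.prems(3)]]; simp)+
  have IH1: "sat_template D n T w (template \<sigma> K (Suc j) \<rho> \<eta> \<alpha>) \<longleftrightarrow> msat K v V (Suc j) \<alpha> T"
    by (rule Plus.IH(1)) (use Plus.prems agree in \<open>auto simp: agree_so_def\<close>)
  have IH2: "sat_template D n T w (template \<sigma> K ?j' \<rho> \<eta> \<beta>) \<longleftrightarrow> msat K v V ?j' \<beta> T"
    by (rule Plus.IH(2)) (use Plus.prems agree in \<open>auto simp: agree_so_def\<close>)
  have 1: "sat_template D n T w (add_cts (all_ct K True j 0 # zero_cts K ?bs) (template \<sigma> K (Suc j) \<rho> \<eta> \<alpha>))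
      \<longleftrightarrow> (code n K j [] \<in> T \<and> T \<inter> block_vars K ?bs = {}) \<and> msat K v V (Suc j) \<alpha> T"
    unfolding IH1[symmetric] by (rule sat_add_cts) (simp add: sat_zero_cts sat_all_ct block_0)
  have 2: "sat_template D n T w (add_cts (all_ct K False j 0 # zero_cts K ?as) (template \<sigma> K ?j' \<rho> \<eta> \<beta>))
      \<longleftrightarrow> (code n K j [] \<notin> T \<and> T \<inter> block_vars K ?as = {}) \<and> msat K v V ?j' \<beta> T"
    unfolding IH2[symmetric] by (rule sat_add_cts) (simp add: sat_zero_cts sat_all_ct block_0)
  show ?case
    by (simp only: template.simps msat.simps Let_def sat_template_append 1 2) argo
next
  case (SumFO x \<alpha>)
  have "sat_template D n T (w(j := i)) (add_cts (onehot_cts K j)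
        (template \<sigma> K (Suc j) (\<rho>(x := j)) \<eta> \<alpha>)) \<longleftrightarrow>
      T \<inter> block n K j 1 = {code n K j [i]} \<and> msat K (v(x := us ! i)) V (Suc j) \<alpha> T"
    if i: "i < n" for i
  proof -
    have agree: "agree (\<rho>(x := j)) (Suc j) (w(j := i)) (v(x := us ! i)) (fv_qso \<alpha>)"
      by (rule agree_upd) (use SumFO.prems i in auto)
    have IH: "sat_template D n T (w(j := i)) (template \<sigma> K (Suc j) (\<rho>(x := j)) \<eta> \<alpha>) \<longleftrightarrow>
        msat K (v(x := us ! i)) V (Suc j) \<alpha> T"
      by (rule SumFO.IH[OF _ _ agree]) (use SumFO.prems in auto)
    show ?thesis
      unfolding IH[symmetric]
    proof (rule sat_add_cts)
      fix rs cts' w'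
      assume *: "(rs, cts') \<in> set (template \<sigma> K (Suc j) (\<rho>(x := j)) \<eta> \<alpha>)"
        "w' \<in> set (envs n rs (w(j := i)))"
      have "j \<notin> set rs" using template_regs[OF *(1)] by auto
      with envs_other[OF *(2)] have "w' j = i" by simp
      then show "(\<forall>ct \<in> set (onehot_cts K j). sat_ct D n T w' ct) =
          (T \<inter> block n K j 1 = {code n K j [i]})"
        using sat_onehot_cts[of n K w' j D T] n_pos SumFO.prems i by simp
    qed
  qed
  then show ?case
    unfolding template.simps msat.simps sat_add_reg by blast
next
  case (SumSO X \<alpha>)
  have IH: "sat_template D n T w (template \<sigma> K (Suc j) \<rho> (\<eta>(X := j)) \<alpha>) \<longleftrightarrow>
      msat K v (V(X := decode K j (arity X) T)) (Suc j) \<alpha> T"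
    by (rule SumSO.IH) (use SumSO.prems agree_mono[of \<rho> j w v _ "Suc j"] in \<open>auto simp: agree_so_def\<close>)
  have "sat_template D n T w (template \<sigma> K j \<rho> \<eta> (SumSO X \<alpha>)) \<longleftrightarrow>
      True \<and> sat_template D n T w (template \<sigma> K (Suc j) \<rho> (\<eta>(X := j)) \<alpha>)"
    unfolding template.simps by (rule sat_add_cts) (simp add: sat_free_ct)
  then show ?case by (simp add: IH)
qed

text \<open>A sentence has no free second-order variables, so the two inclusions give all its
  disjuncts the same variables, as \<open>count_disj2sat_inst\<close> requires. The lower inclusion
  rests on the tautologies, the one-hot clauses and the clauses that fix selectors and blocks of
  other summands.\<close>

lemma template_vars:
  assumes "wf_qso \<sigma> \<alpha>" "agree \<rho> j w v (fv_qso \<alpha>)"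
    and "(rs, cts) \<in> set (template \<sigma> K j \<rho> \<eta> \<alpha>)" "w' \<in> set (envs n rs w)"
  shows "block_vars K (blocks j \<alpha>) \<subseteq> (\<Union>ct \<in> set cts. ct_vars D n w' ct) \<and>
    (\<Union>ct \<in> set cts. ct_vars D n w' ct) \<subseteq>
      block_vars K (blocks j \<alpha>) \<union> (\<Union>X \<in> sov_qso \<alpha>. block n K (\<eta> X) (arity X))"
  using assms
proof (induction \<alpha> arbitrary: j \<rho> \<eta> w v rs cts)
  case (Formula \<phi>)
  then have "ct_vars D n w' ct \<subseteq> (\<Union>X \<in> sov_sigma2 \<phi>. block n K (\<eta> X) (arity X))"
    if "ct \<in> set cts" for ct
    using sigma2_vars that by simp
  then have "(\<Union>ct \<in> set cts. ct_vars D n w' ct) \<subseteq>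
      (\<Union>X \<in> sov_sigma2 \<phi>. block n K (\<eta> X) (arity X))"
    by (rule UN_least)
  then show ?case by simp
next
  case (Const s)
  then obtain i where "i < s" "cts = map (\<lambda>i'. all_ct K (i' = i) (j + i') 0) [0..<s]" by auto
  then show ?case by (auto simp: vars_all_ct block_vars_def)
next
  case (Plus \<alpha> \<beta>)
  let ?as = "blocks (Suc j) \<alpha>"
  let ?j' = "Suc j + length ?as"
  let ?bs = "blocks ?j' \<beta>"
  have agree: "agree \<rho> (Suc j) w v (fv_qso \<alpha>)" "agree \<rho> ?j' w v (fv_qso \<beta>)"
    by (rule agree_mono[OF agree_subset[OF Plus.prems(2)]]; simp)+
  from Plus.prems(3) consider
    cts' where "(rs, cts') \<in> set (template \<sigma> K (Suc j) \<rho> \<eta> \<alpha>)"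
      "cts = all_ct K True j 0 # zero_cts K ?bs @ cts'"
  | cts' where "(rs, cts') \<in> set (template \<sigma> K ?j' \<rho> \<eta> \<beta>)"
      "cts = all_ct K False j 0 # zero_cts K ?as @ cts'"
    by (auto simp: Let_def add_cts_def)
  then show ?case
  proof cases
    case 1
    have "block_vars K ?as \<subseteq> (\<Union>ct \<in> set cts'. ct_vars D n w' ct) \<and>
      (\<Union>ct \<in> set cts'. ct_vars D n w' ct) \<subseteq>
        block_vars K ?as \<union> (\<Union>X \<in> sov_qso \<alpha>. block n K (\<eta> X) (arity X))"
      by (rule Plus.IH(1)[OF _ _ 1(1)]) (use Plus.prems agree in auto)
    moreover have "(\<Union>ct \<in> set cts. ct_vars D n w' ct) =
        block n K j 0 \<union> block_vars K ?bs \<union> (\<Union>ct \<in> set cts'. ct_vars D n w' ct)"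
      by (simp add: 1(2) vars_all_ct vars_zero_cts Un_assoc)
    ultimately show ?thesis by (auto simp: Let_def)
  next
    case 2
    have "block_vars K ?bs \<subseteq> (\<Union>ct \<in> set cts'. ct_vars D n w' ct) \<and>
      (\<Union>ct \<in> set cts'. ct_vars D n w' ct) \<subseteq>
        block_vars K ?bs \<union> (\<Union>X \<in> sov_qso \<beta>. block n K (\<eta> X) (arity X))"
      by (rule Plus.IH(2)[OF _ _ 2(1)]) (use Plus.prems agree in auto)
    moreover have "(\<Union>ct \<in> set cts. ct_vars D n w' ct) =
        block n K j 0 \<union> block_vars K ?as \<union> (\<Union>ct \<in> set cts'. ct_vars D n w' ct)"
      by (simp add: 2(2) vars_all_ct vars_zero_cts Un_assoc)
    ultimately show ?thesis by (auto simp: Let_def)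
  qed
next
  case (SumFO x \<alpha>)
  from SumFO.prems(3) obtain rs' cts' where
    1: "(rs', cts') \<in> set (template \<sigma> K (Suc j) (\<rho>(x := j)) \<eta> \<alpha>)"
      "rs = j # rs'" "cts = onehot_cts K j @ cts'"
    by (auto simp: add_cts_def add_reg_def)
  with SumFO.prems(4) obtain i where i: "i < n" "w' \<in> set (envs n rs' (w(j := i)))" by auto
  have "agree (\<rho>(x := j)) (Suc j) (w(j := i)) (v(x := us ! i)) (fv_qso \<alpha>)"
    using SumFO.prems(2) i(1) by (intro agree_upd) auto
  from SumFO.IH[OF _ this 1(1) i(2)] SumFO.prems(1)
  have IH: "block_vars K (blocks (Suc j) \<alpha>) \<subseteq> (\<Union>ct \<in> set cts'. ct_vars D n w' ct) \<and>
    (\<Union>ct \<in> set cts'. ct_vars D n w' ct) \<subseteq>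
      block_vars K (blocks (Suc j) \<alpha>) \<union> (\<Union>X \<in> sov_qso \<alpha>. block n K (\<eta> X) (arity X))"
    by simp
  have "j \<notin> set rs'" using template_regs[OF 1(1)] by auto
  with envs_other[OF i(2)] i(1) have "w' j < n" by simp
  then have "(\<Union>ct \<in> set cts. ct_vars D n w' ct) =
      block n K j 1 \<union> (\<Union>ct \<in> set cts'. ct_vars D n w' ct)"
    by (simp only: 1(3) set_append UN_Un vars_onehot_cts)
  with IH show ?case by auto
next
  case (SumSO X \<alpha>)
  from SumSO.prems(3) obtain cts' where
    1: "(rs, cts') \<in> set (template \<sigma> K (Suc j) \<rho> (\<eta>(X := j)) \<alpha>)"
      "cts = free_ct K j (arity X) # cts'"
    by (auto simp: add_cts_def)
  have "agree \<rho> (Suc j) w v (fv_qso \<alpha>)"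
    using agree_mono[OF SumSO.prems(2), of "Suc j"] by simp
  from SumSO.IH[OF _ this 1(1) SumSO.prems(4)] SumSO.prems(1)
  have IH: "block_vars K (blocks (Suc j) \<alpha>) \<subseteq> (\<Union>ct \<in> set cts'. ct_vars D n w' ct)"
    "(\<Union>ct \<in> set cts'. ct_vars D n w' ct) \<subseteq>
      block_vars K (blocks (Suc j) \<alpha>) \<union> (\<Union>Y \<in> sov_qso \<alpha>. block n K ((\<eta>(X := j)) Y) (arity Y))"
    by simp_all
  have U: "(\<Union>ct \<in> set cts. ct_vars D n w' ct) =
      block n K j (arity X) \<union> (\<Union>ct \<in> set cts'. ct_vars D n w' ct)"
    by (simp add: 1(2) vars_free_ct)
  \<comment> \<open>Binding \<open>X\<close> moves its block from the free to the bound
    side.\<close>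
  have "(\<Union>Y \<in> sov_qso \<alpha>. block n K ((\<eta>(X := j)) Y) (arity Y)) \<subseteq>
      block n K j (arity X) \<union> (\<Union>Y \<in> sov_qso \<alpha> - {X}. block n K (\<eta> Y) (arity Y))"
  proof (rule UN_least)
    fix Y assume "Y \<in> sov_qso \<alpha>"
    then show "block n K ((\<eta>(X := j)) Y) (arity Y) \<subseteq>
        block n K j (arity X) \<union> (\<Union>Y \<in> sov_qso \<alpha> - {X}. block n K (\<eta> Y) (arity Y))"
      by (cases "Y = X") (simp, simp, blast)
  qed
  from order_trans[OF IH(2) Un_mono[OF order_refl this]]
  have IH': "(\<Union>ct \<in> set cts'. ct_vars D n w' ct) \<subseteq>
      (block n K j (arity X) \<union> block_vars K (blocks (Suc j) \<alpha>)) \<union>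
      (\<Union>Y \<in> sov_qso \<alpha> - {X}. block n K (\<eta> Y) (arity Y))"
    by (simp only: Un_ac)
  have "block_vars K (blocks j (SumSO X \<alpha>)) =
      block n K j (arity X) \<union> block_vars K (blocks (Suc j) \<alpha>)"
    by simp
  then show ?case
    unfolding U sov_qso.simps by (simp only:) (intro conjI Un_mono[OF order_refl IH(1)] Un_least[OF _ IH'], simp add: Un_assoc)
qed

section \<open>Counting assignments block by block\<close>

lemma decode_cong: "T \<inter> block n K j k = T' \<inter> block n K j k \<Longrightarrow> decode K j k T = decode K j k T'"
  unfolding decode_def using code_in_block by blast

text \<open>Locality: the part of an assignment that belongs to an outer binder or selector can be
  added or removed without effect on the inner expression.\<close>

lemma msat_cong:
  "T \<inter> block_vars K (blocks j \<alpha>) = T' \<inter> block_vars K (blocks j \<alpha>) \<Longrightarrow>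
   msat K v V j \<alpha> T = msat K v V j \<alpha> T'"
proof (induction \<alpha> arbitrary: j v V)
  case (Plus \<alpha> \<beta>)
  let ?as = "blocks (Suc j) \<alpha>"
  let ?j' = "Suc j + length ?as"
  let ?bs = "blocks ?j' \<beta>"
  have *: "T \<inter> (block n K j 0 \<union> (block_vars K ?as \<union> block_vars K ?bs)) =
      T' \<inter> (block n K j 0 \<union> (block_vars K ?as \<union> block_vars K ?bs))"
    using Plus.prems by (simp add: Let_def)
  have a: "T \<inter> block_vars K ?as = T' \<inter> block_vars K ?as" using * by blast
  have b: "T \<inter> block_vars K ?bs = T' \<inter> block_vars K ?bs" using * by blast
  have c: "code n K j [] \<in> T \<longleftrightarrow> code n K j [] \<in> T'" using * by (auto simp: block_0)
  show ?case
    using Plus.IH(1)[OF a] Plus.IH(2)[OF b] a b c by (simp add: Let_def)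
next
  case (SumFO x \<alpha>)
  let ?as = "blocks (Suc j) \<alpha>"
  have *: "T \<inter> (block n K j 1 \<union> block_vars K ?as) = T' \<inter> (block n K j 1 \<union> block_vars K ?as)"
    using SumFO.prems by simp
  have a: "T \<inter> block_vars K ?as = T' \<inter> block_vars K ?as" using * by blast
  have b: "T \<inter> block n K j 1 = T' \<inter> block n K j 1" using * by blast
  show ?case unfolding msat.simps b SumFO.IH[OF a] by (rule refl)
next
  case (SumSO X \<alpha>)
  let ?as = "blocks (Suc j) \<alpha>"
  have *: "T \<inter> (block n K j (arity X) \<union> block_vars K ?as) = T' \<inter> (block n K j (arity X) \<union> block_vars K ?as)"
    using SumSO.prems by simp
  have a: "T \<inter> block_vars K ?as = T' \<inter> block_vars K ?as" using * by blast
  have b: "decode K j (arity X) T = decode K j (arity X) T'" by (rule decode_cong) (use * in blast)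
  show ?case unfolding msat.simps b SumSO.IH[OF a] by (rule refl)
qed auto

lemma tuples_univ: "tuples (univ A) k = map ((!) us) ` tuples {..<n} k"
proof
  show "tuples (univ A) k \<subseteq> map ((!) us) ` tuples {..<n} k"
  proof
    fix xs assume xs: "xs \<in> tuples (univ A) k"
    then have "xs \<in> lists ((!) us ` {..<n})" by (auto simp: tuples_def univ_image in_lists_conv_set)
    then obtain ts where "xs = map ((!) us) ts" "ts \<in> lists {..<n}"
      unfolding lists_image by blast
    with xs show "xs \<in> map ((!) us) ` tuples {..<n} k" by (auto simp: tuples_def)
  qed
qed (fastforce simp: tuples_def univ_image)

text \<open>This turns the sum over all relations into a sum over all subsets of the block.\<close>

lemma bij_decode:
  assumes "k \<le> K"
  shows "bij_betw (decode K j k) (Pow (block n K j k)) (Pow (tuples (univ A) k))"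
proof -
  let ?f = "\<lambda>B. code n K j ` {ts \<in> tuples {..<n} k. map ((!) us) ts \<in> B}"
  have inj: "ts = ts'" if "ts \<in> tuples {..<n} k" "ts' \<in> tuples {..<n} k" "code n K j ts = code n K j ts'"
    for ts ts'
    using code_inj[OF that(1,2) assms assms n_pos that(3)] by simp
  show ?thesis
  proof (rule bij_betw_byWitness[where f' = ?f])
    show "\<forall>T \<in> Pow (block n K j k). ?f (decode K j k T) = T"
    proof
      fix T assume "T \<in> Pow (block n K j k)"
      then have T: "T \<subseteq> code n K j ` tuples {..<n} k" by (simp add: block_def)
      have "?f (decode K j k T) = code n K j ` {ts \<in> tuples {..<n} k. code n K j ts \<in> T}"
        using map_in_decode by (intro arg_cong[where f = "image _"]) auto
      also have "\<dots> = T" using T by blast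
      finally show "?f (decode K j k T) = T" .
    qed
    show "\<forall>B \<in> Pow (tuples (univ A) k). decode K j k (?f B) = B"
    proof
      fix B assume "B \<in> Pow (tuples (univ A) k)"
      then have B: "B \<subseteq> map ((!) us) ` tuples {..<n} k" by (simp add: tuples_univ)
      have "{ts \<in> tuples {..<n} k. code n K j ts \<in> ?f B} = {ts \<in> tuples {..<n} k. map ((!) us) ts \<in> B}"
        using inj by blast
      then have "decode K j k (?f B) = map ((!) us) ` {ts \<in> tuples {..<n} k. map ((!) us) ts \<in> B}"
        unfolding decode_def by (rule arg_cong)
      also have "\<dots> = B" using B by blast
      finally show "decode K j k (?f B) = B" .
    qed
    show "decode K j k ` Pow (block n K j k) \<subseteq> Pow (tuples (univ A) k)"
      unfolding decode_def tuples_univ by blast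
    show "?f ` Pow (tuples (univ A) k) \<subseteq> Pow (block n K j k)"
      unfolding block_def by blast
  qed
qed

text \<open>Each binder splits an assignment into its own block and the rest. The selector of a sum
  makes the two alternatives disjoint, the one-hot condition matches first-order values, and
  \<open>bij_decode\<close> matches relations.\<close>

lemma card_msat:
  "max_arity \<alpha> \<le> K \<Longrightarrow>
   card {T. T \<subseteq> block_vars K (blocks j \<alpha>) \<and> msat K v V j \<alpha> T} = qso_sem A v V \<alpha>"
proof (induction \<alpha> arbitrary: j v V)
  case (Formula \<phi>)
  \<comment> \<open>There is no block, so the empty assignment is the only candidate and the count
    is 0 or 1.\<close>
  have "{T. T \<subseteq> block_vars K (blocks j (Formula \<phi>)) \<and> msat K v V j (Formula \<phi>) T} =
      (if sat_sigma2 A v V \<phi> then {{}} else {})"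
    by auto
  then show ?case by simp
next
  case (Const s)
  let ?c = "\<lambda>i. {code n K (j + i) []}"
  have "{T. T \<subseteq> block_vars K (blocks j (Const s)) \<and> msat K v V j (Const s) T} = ?c ` {..<s}"
  proof (intro set_eqI iffI)
    fix T assume "T \<in> {T. T \<subseteq> block_vars K (blocks j (Const s)) \<and> msat K v V j (Const s) T}"
    then have "T \<inter> block_vars K (blocks j (Const s)) = T"
      "\<exists>i<s. T \<inter> block_vars K (blocks j (Const s)) = ?c i" by auto
    then show "T \<in> ?c ` {..<s}" by auto
  next
    fix T assume "T \<in> ?c ` {..<s}"
    then obtain i where i: "i < s" "T = ?c i" by auto
    then have "?c i \<inter> block_vars K (blocks j (Const s)) = ?c i"
      unfolding block_vars_Const by blast
    with i show "T \<in> {T. T \<subseteq> block_vars K (blocks j (Const s)) \<and> msat K v V j (Const s) T}"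
      by (simp only: mem_Collect_eq msat.simps) blast
  qed
  moreover have "card (?c ` {..<s}) = s"
    by (subst card_image) (auto simp: inj_on_def code_nil_inj)
  ultimately show ?case by simp
next
  case (Plus \<alpha> \<beta>)
  let ?as = "blocks (Suc j) \<alpha>"
  let ?j' = "Suc j + length ?as"
  let ?bs = "blocks ?j' \<beta>"
  let ?P = "block_vars K ?as" and ?Q = "block_vars K ?bs"
  let ?c = "code n K j []"
  let ?SA = "{T. T \<subseteq> ?P \<and> msat K v V (Suc j) \<alpha> T}"
  let ?SB = "{T. T \<subseteq> ?Q \<and> msat K v V ?j' \<beta> T}"
  have PQ: "?P \<inter> ?Q = {}" "?c \<notin> ?P" "?c \<notin> ?Q"
    using block_vars_blocks2_disjoint[of \<alpha> K \<beta> "Suc j"]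
      block_vars_blocks_disjoint[of 0 K \<alpha> j "Suc j"] block_vars_blocks_disjoint[of 0 K \<beta> j ?j']
      Plus.prems by (auto simp: block_0)
  have ins: "msat K v V (Suc j) \<alpha> (insert ?c T) \<longleftrightarrow> msat K v V (Suc j) \<alpha> T" for T
    by (rule msat_cong) (use PQ in blast)
  \<comment> \<open>Assignments for the left summand contain the selector \<open>?c\<close> and
    those for the right do not; the blocks of the other side are empty in both cases.\<close>
  have "{T. T \<subseteq> block_vars K (blocks j (Plus \<alpha> \<beta>)) \<and> msat K v V j (Plus \<alpha> \<beta>) T} =
      insert ?c ` ?SA \<union> ?SB" (is "?L = ?R")
  proof
    show "?L \<subseteq> ?R"
    proof
      fix T assume "T \<in> ?L"
      then have T: "T \<subseteq> insert ?c (?P \<union> ?Q)" "msat K v V j (Plus \<alpha> \<beta>) T"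
        by (auto simp: Let_def block_0)
      show "T \<in> ?R"
      proof (cases "?c \<in> T")
        case True
        with T have "T - {?c} \<subseteq> ?P" "msat K v V (Suc j) \<alpha> T" by (auto simp: Let_def)
        moreover have "T = insert ?c (T - {?c})" using True by blast
        ultimately have "T - {?c} \<in> ?SA" using ins[of "T - {?c}"] by simp
        with \<open>T = _\<close> show ?thesis by blast
      next
        case False
        with T have "T \<subseteq> ?Q" "msat K v V ?j' \<beta> T" by (auto simp: Let_def)
        then show ?thesis by blast
      qed
    qed
    show "?R \<subseteq> ?L"
      using PQ ins by (auto simp: Let_def block_0)
  qed
  moreover have "card (insert ?c ` ?SA \<union> ?SB) = card ?SA + card ?SB"
  proof -
    have "inj_on (insert ?c) ?SA"
      by (rule inj_on_inverseI[where g = "\<lambda>T. T - {?c}"]) (use PQ(2) in auto)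
    then have "card (insert ?c ` ?SA) = card ?SA" by (rule card_image)
    moreover have "finite {T. T \<subseteq> block_vars K bs \<and> R T}" for bs R
      by (rule finite_subset[of _ "Pow (block_vars K bs)"]) (auto simp: finite_block_vars)
    moreover have "insert ?c ` ?SA \<inter> ?SB = {}" using PQ(3) by blast
    ultimately show ?thesis by (simp add: card_Un_disjoint)
  qed
  ultimately show ?case
    using Plus.IH(1)[of "Suc j" v V] Plus.IH(2)[of ?j' v V] Plus.prems by simp
next
  case (SumFO x \<alpha>)
  let ?P = "block n K j 1" and ?Q = "block_vars K (blocks (Suc j) \<alpha>)"
  let ?c = "\<lambda>i. {code n K j [i]}"
  let ?m = "\<lambda>i T. msat K (v(x := us ! i)) V (Suc j) \<alpha> T"
  have K: "1 \<le> K" "max_arity \<alpha> \<le> K" using SumFO.prems by auto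
  have PQ: "?P \<inter> ?Q = {}" by (rule block_vars_blocks_disjoint) (use K in auto)
  have eq: "msat K v V j (SumFO x \<alpha>) (T1 \<union> T2) \<longleftrightarrow> (\<exists>i<n. T1 = ?c i \<and> ?m i T2)"
    if "T1 \<subseteq> ?P" "T2 \<subseteq> ?Q" for T1 T2
  proof -
    have "(T1 \<union> T2) \<inter> ?P = T1" using that PQ by blast
    moreover have "?m i (T1 \<union> T2) \<longleftrightarrow> ?m i T2" for i
      by (rule msat_cong) (use that PQ in blast)
    ultimately show ?thesis by simp
  qed
  have inj: "inj_on ?c {..<n}" using code_1_inj[OF n_pos K(1)] by (auto simp: inj_on_def)
  have "card {T. T \<subseteq> ?P \<union> ?Q \<and> msat K v V j (SumFO x \<alpha>) T} =
      (\<Sum>T1 \<in> Pow ?P. card {T2. T2 \<subseteq> ?Q \<and> msat K v V j (SumFO x \<alpha>) (T1 \<union> T2)})"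
    by (rule card_subsets_Un[OF finite_block finite_block_vars PQ])
  also have "\<dots> = (\<Sum>T1 \<in> Pow ?P. card {T2. T2 \<subseteq> ?Q \<and> (\<exists>i<n. T1 = ?c i \<and> ?m i T2)})"
    by (intro sum.cong refl arg_cong[where f = card] Collect_cong conj_cong eq) auto
  \<comment> \<open>A subset of the block that is not a singleton \<open>?c i\<close> contributes no
    assignment.\<close>
  also have "\<dots> = (\<Sum>T1 \<in> ?c ` {..<n}. card {T2. T2 \<subseteq> ?Q \<and> (\<exists>i<n. T1 = ?c i \<and> ?m i T2)})"
  proof (rule sum.mono_neutral_right)
    show "?c ` {..<n} \<subseteq> Pow ?P" using block_1[of n K j] by auto
    have "{T2. T2 \<subseteq> ?Q \<and> (\<exists>i<n. T1 = ?c i \<and> ?m i T2)} = {}" if "T1 \<notin> ?c ` {..<n}" for T1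
      using that by blast
    then show "\<forall>T1 \<in> Pow ?P - ?c ` {..<n}. card {T2. T2 \<subseteq> ?Q \<and> (\<exists>i<n. T1 = ?c i \<and> ?m i T2)} = 0"
      by (metis (no_types, lifting) DiffD2 card.empty)
  qed (simp add: finite_block)
  also have "\<dots> = (\<Sum>i<n. card {T2. T2 \<subseteq> ?Q \<and> ?m i T2})"
  proof -
    have "(\<exists>i'<n. ?c i = ?c i' \<and> ?m i' T2) \<longleftrightarrow> ?m i T2" if "i < n" for i T2
      using that inj by (auto simp: inj_on_def)
    then show ?thesis
      unfolding sum.reindex[OF inj] o_def by (intro sum.cong refl) simp
  qed
  also have "\<dots> = (\<Sum>i<n. qso_sem A (v(x := us ! i)) V \<alpha>)"
    by (intro sum.cong refl SumFO.IH K)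
  also have "\<dots> = qso_sem A v V (SumFO x \<alpha>)"
    by (simp add: univ_image sum.reindex[OF inj_nth])
  finally show ?case by simp
next
  case (SumSO X \<alpha>)
  let ?k = "arity X"
  let ?P = "block n K j ?k" and ?Q = "block_vars K (blocks (Suc j) \<alpha>)"
  let ?m = "\<lambda>B T. msat K v (V(X := B)) (Suc j) \<alpha> T"
  have K: "?k \<le> K" "max_arity \<alpha> \<le> K" using SumSO.prems by auto
  have PQ: "?P \<inter> ?Q = {}" by (rule block_vars_blocks_disjoint) (use K in auto)
  have eq: "msat K v V j (SumSO X \<alpha>) (T1 \<union> T2) \<longleftrightarrow> ?m (decode K j ?k T1) T2"
    if "T1 \<subseteq> ?P" "T2 \<subseteq> ?Q" for T1 T2
  proof -
    have "decode K j ?k (T1 \<union> T2) = decode K j ?k T1"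
      by (rule decode_cong) (use that PQ in blast)
    moreover have "?m B (T1 \<union> T2) \<longleftrightarrow> ?m B T2" for B
      by (rule msat_cong) (use that PQ in blast)
    ultimately show ?thesis by simp
  qed
  have "card {T. T \<subseteq> ?P \<union> ?Q \<and> msat K v V j (SumSO X \<alpha>) T} =
      (\<Sum>T1 \<in> Pow ?P. card {T2. T2 \<subseteq> ?Q \<and> msat K v V j (SumSO X \<alpha>) (T1 \<union> T2)})"
    by (rule card_subsets_Un[OF finite_block finite_block_vars PQ])
  also have "\<dots> = (\<Sum>T1 \<in> Pow ?P. card {T2. T2 \<subseteq> ?Q \<and> ?m (decode K j ?k T1) T2})"
    by (intro sum.cong refl arg_cong[where f = card] Collect_cong conj_cong eq) auto
  also have "\<dots> = (\<Sum>T1 \<in> Pow ?P. qso_sem A v (V(X := decode K j ?k T1)) \<alpha>)"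
    by (intro sum.cong refl SumSO.IH K)
  also have "\<dots> = qso_sem A v V (SumSO X \<alpha>)"
    unfolding qso_sem.simps
    by (rule sum.reindex_bij_betw[OF bij_decode[OF K(1)], of "\<lambda>B. qso_sem A v (V(X := B)) \<alpha>"])
  finally show ?case by simp
qed

end

section \<open>The reduction and its correctness\<close>

definition sentence_template :: "vocabulary \<Rightarrow> qso \<Rightarrow> template" where
  "sentence_template \<sigma> \<alpha> = template \<sigma> (max_arity \<alpha>) 0 (\<lambda>_. 0) (\<lambda>_. 0) \<alpha>"

text \<open>Expressed through the encoded input, with \<open>n\<close> recovered as its leading
  block of ones, so that the generator computes literally this function.\<close>

definition reduction :: "vocabulary \<Rightarrow> qso \<Rightarrow> 'a ordered_structure \<Rightarrow> pformula" where
  "reduction \<sigma> \<alpha> A =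
     inst (enc_structure \<sigma> A) (uval (enc_structure \<sigma> A)) (\<lambda>_. 0) (sentence_template \<sigma> \<alpha>)"

lemma (in encoded_structure) count_reduction:
  assumes "qso_sentence \<sigma> \<alpha>"
  shows "count_disj2sat (reduction \<sigma> \<alpha> A) = qso_count \<alpha> A"
proof -
  let ?K = "max_arity \<alpha>"
  let ?v = "\<lambda>_. SOME a. a \<in> univ A"
  let ?P = "block_vars ?K (blocks 0 \<alpha>)"
  have \<alpha>: "wf_qso \<sigma> \<alpha>" "fv_qso \<alpha> = {}" "sov_qso \<alpha> = {}"
    using assms by (auto simp: qso_sentence_def)
  have "count_disj2sat (reduction \<sigma> \<alpha> A) =
      card {T. T \<subseteq> ?P \<and> sat_template D n T (\<lambda>_. 0) (sentence_template \<sigma> \<alpha>)}"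
    unfolding reduction_def D_def[symmetric] uval_D sentence_template_def
  proof (rule count_disj2sat_inst)
    fix rs cts w'
    assume "(rs, cts) \<in> set (template \<sigma> ?K 0 (\<lambda>_. 0) (\<lambda>_. 0) \<alpha>)" "w' \<in> set (envs n rs (\<lambda>_. 0))"
    from template_vars[OF \<alpha>(1) _ this, of ?v] \<alpha>
    show "(\<Union>ct \<in> set cts. ct_vars D n w' ct) = ?P" by (auto simp: agree_def)
  qed
  also have "\<dots> = card {T. T \<subseteq> ?P \<and> msat ?K ?v (\<lambda>_. {}) 0 \<alpha> T}"
    unfolding sentence_template_def
    by (subst template_sat[OF \<alpha>(1) order_refl, where v = ?v and V = "\<lambda>_. {}"])
      (simp_all add: \<alpha> agree_def agree_so_def)
  also have "\<dots> = qso_count \<alpha> A"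
    by (simp add: card_msat qso_count_def)
  finally show ?thesis .
qed

lemma reduction_disj2sat:
  assumes "qso_sentence \<sigma> \<alpha>"
  shows "reduction \<sigma> \<alpha> A \<in> disj2sat"
  unfolding reduction_def sentence_template_def
proof (rule inst_disj2sat)
  fix rs cts rs' b ls
  assume *: "(rs, cts) \<in> set (template \<sigma> (max_arity \<alpha>) 0 (\<lambda>_. 0) (\<lambda>_. 0) \<alpha>)" "(rs', b, ls) \<in> set cts"
  have "wf_qso \<sigma> \<alpha>" using assms by (simp add: qso_sentence_def)
  from template_length[OF this *] show "length ls \<le> 2" by simp
qed

theorem theorem2:
  fixes \<sigma> :: vocabulary and \<alpha> :: qso
  assumes "qso_sentence \<sigma> \<alpha>"
  shows "\<exists>h. parsimonious_reduction
               (ordered_structures \<sigma> :: 'a ordered_structure set) (enc_structure \<sigma>) (qso_count \<alpha>)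
               disj2sat enc_pformula count_disj2sat h"
proof (rule exI[of _ "reduction \<sigma> \<alpha>"], unfold parsimonious_reduction_def, intro conjI ballI)
  show "poly_time_computable (ordered_structures \<sigma> :: 'a ordered_structure set) (enc_structure \<sigma>)
      enc_pformula (reduction \<sigma> \<alpha>)"
    by (rule poly_time_computable_gval[where g = "gformula (sentence_template \<sigma> \<alpha>)"])
      (simp add: gval_gformula reduction_def)
next
  fix A :: "'a ordered_structure" assume "A \<in> ordered_structures \<sigma>"
  then interpret encoded_structure \<sigma> A by unfold_locales
  show "qso_count \<alpha> A = count_disj2sat (reduction \<sigma> \<alpha> A)"
    by (simp add: count_reduction[OF assms])
qed (rule reduction_disj2sat[OF assms])

end
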